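(* Let $\{(z^k,w_1^k,\dots,w_{n-1}^k)\}$, $\{(x_i^k,y_i^k)\}$ ($i=1,\dots,n$), $\{\alpha_k\}$ and $\{\rho_i^k\}$ be the (infinite) sequences generated by Algorithm 2 (described in the context). Assume that $\alpha\in[0,1)$, $\overline{\beta}\in(0,2)$ and $\{\alpha_k\}$ satisfy, for some $\overline{\alpha}>0$, $$0\le\alpha_k\le\alpha_{k+1}\le\alpha<\overline{\alpha}<1\qquad\forall k\ge 0$$ and $$\overline{\beta}=\overline{\beta}(\overline{\alpha}):=\frac{2(\overline{\alpha}-1)^2}{2(\overline{\alpha}-1)^2+3\overline{\alpha}-1}.$$ Assume also that there are constants $\underline{\rho},\overline{\rho}$ such that, for $i=1,\dots,n$, $$0<\underline{\rho}\le\rho_i^k\le\overline{\rho}<\infty\qquad\forall k\ge 0.$$ Then there exists $(z^\infty,w_1^\infty,\dots,w_{n-1}^\infty)\in\mathcal{S}$ such that $z^k\rightharpoonup z^\infty$ and $w_i^k\rightharpoonup w_i^\infty$ for $i=1,\dots,n-1$ (weak convergence). Furthermore, $x_i^k\rightharpoonup G_iz^\infty$ and $y_i^k\rightharpoonup w_i^\infty$ for $i=1,\dots,n$, where $w_n^\infty:=-\sum_{i=1}^{n-1}G_i^*w_i^\infty$.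
   Context: Setting. Let $n\ge 2$, let $\mathcal{H}_0,\mathcal{H}_1,\dots,\mathcal{H}_n$ be real Hilbert spaces with $\mathcal{H}_0=\mathcal{H}_n$ (inner products all denoted $\langle\cdot,\cdot\rangle$, norms $\|\cdot\|$). Let $\boldsymbol{\mathcal{H}}=\mathcal{H}_0\times\mathcal{H}_1\times\dots\times\mathcal{H}_{n-1}$ be endowed, for a given $\gamma>0$, with $\langle(z,w),(z',w')\rangle_\gamma=\gamma\langle z,z'\rangle+\sum_{i=1}^{n-1}\langle w_i,w_i'\rangle$ and norm $\|(z,w)\|_\gamma^2=\gamma\|z\|^2+\sum_{i=1}^{n-1}\|w_i\|^2$. For $i=1,\dots,n$, $T_i:\mathcal{H}_i\rightrightarrows\mathcal{H}_i$ is (set-valued) maximal monotone and $G_i:\mathcal{H}_0\to\mathcal{H}_i$ is bounded linear, with $G_n=I$ the identity. It is assumed that there is at least one $z\in\mathcal{H}_0$ with $0\in\sum_{i=1}^nG_i^*T_iG_i(z)$. The extended solution set is $$\mathcal{S}=\Big\{(z,w_1,\dots,w_{n-1})\in\boldsymbol{\mathcal{H}}\;:\; w_i\in T_i(G_iz),\ i=1,\dots,n-1,\ -\sum_{i=1}^{n-1}G_i^*w_i\in T_n(z)\Big\}.$$ Algorithm 2. (0) Let $(z^{-1},w_1^{-1},\dots,w_{n-1}^{-1})=(z^0,w_1^0,\dots,w_{n-1}^0)\in\boldsymbol{\mathcal{H}}$, $0\le\alpha,\sigma<1$, $0<\underline{\beta}\le\overline{\beta}<2$ and $\gamma>0$ be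 given; set $k=0$. (1) Choose $\alpha_k\in[0,\alpha]$ and let $\widehat z^k=z^k+\alpha_k(z^k-z^{k-1})$, $\widehat w_i^k=w_i^k+\alpha_k(w_i^k-w_i^{k-1})$ for $i=1,\dots,n-1$, and $\widehat w_n^k=-\sum_{i=1}^{n-1}G_i^*\widehat w_i^k$. (2) Choose scalars $\rho_i^k>0$ and compute $(x_i^k,y_i^k)$, with an error $e_i^k\in\mathcal{H}_i$, $i=1,\dots,n$, such that $y_i^k\in T_i(x_i^k)$, $\rho_i^ky_i^k+x_i^k=G_i\widehat z^k+\rho_i^k\widehat w_i^k+e_i^k$ and $\|e_i^k\|^2\le\sigma^2\big(\|G_i\widehat z^k-x_i^k\|^2+\|\rho_i^k(\widehat w_i^k-y_i^k)\|^2\big)$. (3) If $x_i^k=G_ix_n^k$ ($i=1,\dots,n-1$) and $\sum_{i=1}^{n-1}G_i^*y_i^k+y_n^k=0$, stop. Otherwise define $$\varphi_k(\widehat p^k)=\sum_{i=1}^{n-1}\langle G_i\widehat z^k-x_i^k,y_i^k-\widehat w_i^k\rangle+\Big\langle G_n\widehat z^k-x_n^k,\,y_n^k+\sum_{i=1}^{n-1}G_i^*\widehat w_i^k\Big\rangle,$$ $$\theta_k=\frac{\max\{0,\varphi_k(\widehat p^k)\}}{\gamma^{-1}\big\|\sum_{i=1}^{n-1}G_i^*y_i^k+y_n^k\big\|^2+\sum_{i=1}^{n-1}\|x_i^k-G_ix_n^k\|^2}.$$ (4) Choose $\beta_k\in[\underline{\beta},\overline{\beta}]$ and define $z^{k+1}=\widehat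 z^k-\gamma^{-1}\beta_k\theta_k\big(\sum_{i=1}^{n-1}G_i^*y_i^k+y_n^k\big)$ and $w_i^{k+1}=\widehat w_i^k-\beta_k\theta_k(x_i^k-G_ix_n^k)$, $i=1,\dots,n-1$. (5) Let $k\leftarrow k+1$ and go to step (1). Standing assumption: Algorithm 2 never stops at step (3), so it generates infinite sequences. *)

theory Defs
  imports "HOL-Analysis.Analysis" "HOL-Library.Set_Algebras"
begin

text \<open>
  The Hilbert spaces \<open>H 0, \<dots>, H n\<close> (a family of varying length, with members of different
  dimension) are complete linear subspaces of one ambient real inner product space \<open>'a\<close>.
  This loses no generality: such a family embeds isometrically into the direct sum of the
  spaces \<open>H 1, \<dots>, H n\<close>, with \<open>H 0\<close> identified with the summand \<open>H n\<close>.  All notions below are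
  relative to these subspaces; the values of the maps and operators outside of them are irrelevant.
\<close>

definition hilbert_subspace :: "'a::real_inner set \<Rightarrow> bool" where
  "hilbert_subspace U \<longleftrightarrow> subspace U \<and> complete U"

definition bounded_linear_between ::
    "'a::real_inner set \<Rightarrow> 'a set \<Rightarrow> ('a \<Rightarrow> 'a) \<Rightarrow> bool" where
  "bounded_linear_between U V f \<longleftrightarrow>
     (\<forall>x\<in>U. f x \<in> V) \<and>
     (\<forall>x\<in>U. \<forall>y\<in>U. f (x + y) = f x + f y) \<and>
     (\<forall>c. \<forall>x\<in>U. f (c *\<^sub>R x) = c *\<^sub>R f x) \<and>
     (\<exists>K. \<forall>x\<in>U. norm (f x) \<le> K * norm x)"

text \<open>
  The Hilbert space adjoint of \<open>f\<close>, seen as a map with domain \<open>U\<close>.  If \<open>U\<close> is complete and \<open>f\<close> is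
  bounded linear on \<open>U\<close>, the vector described here exists and is unique by the Riesz theorem.
\<close>

definition adjoint_on :: "'a::real_inner set \<Rightarrow> ('a \<Rightarrow> 'a) \<Rightarrow> 'a \<Rightarrow> 'a" where
  "adjoint_on U f w = (THE u. u \<in> U \<and> (\<forall>z\<in>U. inner (f z) w = inner z u))"

definition weakly_converges :: "'a::real_inner set \<Rightarrow> (nat \<Rightarrow> 'a) \<Rightarrow> 'a \<Rightarrow> bool" where
  "weakly_converges U u l \<longleftrightarrow>
     (\<forall>k. u k \<in> U) \<and> l \<in> U \<and> (\<forall>v\<in>U. (\<lambda>k. inner (u k) v) \<longlonglongrightarrow> inner l v)"

definition operator_graph :: "'a set \<Rightarrow> ('a \<Rightarrow> 'a set) \<Rightarrow> ('a \<times> 'a) set" where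
  "operator_graph U T = {(x, y). x \<in> U \<and> y \<in> T x}"

definition monotone_operator :: "'a::real_inner set \<Rightarrow> ('a \<Rightarrow> 'a set) \<Rightarrow> bool" where
  "monotone_operator U T \<longleftrightarrow>
     (\<forall>x\<in>U. T x \<subseteq> U) \<and>
     (\<forall>x\<in>U. \<forall>x'\<in>U. \<forall>y\<in>T x. \<forall>y'\<in>T x'. 0 \<le> inner (x - x') (y - y'))"

definition maximal_monotone :: "'a::real_inner set \<Rightarrow> ('a \<Rightarrow> 'a set) \<Rightarrow> bool" where
  "maximal_monotone U T \<longleftrightarrow>
     monotone_operator U T \<and>
     (\<forall>T'. monotone_operator U T' \<and> operator_graph U T \<subseteq> operator_graph U T' \<longrightarrow>
        operator_graph U T' = operator_graph U T)"

text \<open>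
  An element \<open>(z, w)\<close> of the product \<open>H 0 \<times> H 1 \<times> \<dots> \<times> H (n - 1)\<close> has its last \<open>n - 1\<close> components
  collected in a function \<open>w\<close> on indices; only the values \<open>w 1, \<dots>, w (n - 1)\<close> are significant.
\<close>

definition product_space :: "nat \<Rightarrow> (nat \<Rightarrow> 'a set) \<Rightarrow> ('a \<times> (nat \<Rightarrow> 'a)) set" where
  "product_space n H = H 0 \<times> Pi {1..<n} H"

text \<open>Extends \<open>(w 1, \<dots>, w (n - 1))\<close> by the component \<open>w n = - (\<Sum>i=1..n-1. G i* (w i))\<close>.\<close>

definition dual_extend ::
    "nat \<Rightarrow> (nat \<Rightarrow> 'a::real_inner set) \<Rightarrow> (nat \<Rightarrow> 'a \<Rightarrow> 'a) \<Rightarrow> (nat \<Rightarrow> 'a) \<Rightarrow> nat \<Rightarrow> 'a" where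
  "dual_extend n H G w i =
     (if i = n then - (\<Sum>j=1..<n. adjoint_on (H 0) (G j) (w j)) else w i)"

definition extended_solution_set ::
    "nat \<Rightarrow> (nat \<Rightarrow> 'a::real_inner set) \<Rightarrow> (nat \<Rightarrow> 'a \<Rightarrow> 'a set) \<Rightarrow> (nat \<Rightarrow> 'a \<Rightarrow> 'a) \<Rightarrow>
     ('a \<times> (nat \<Rightarrow> 'a)) set" where
  "extended_solution_set n H T G =
     {(z, w) \<in> product_space n H.
        (\<forall>i\<in>{1..<n}. w i \<in> T i (G i z)) \<and>
        - (\<Sum>i=1..<n. adjoint_on (H 0) (G i) (w i)) \<in> T n z}"

text \<open>
  One iteration of the algorithm evaluates the following at the trial points
  \<open>x = (x 1, \<dots>, x n)\<close>, \<open>y = (y 1, \<dots>, y n)\<close>: the affine separator \<open>\<phi>\<close> as a function of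
  \<open>p = (z, w)\<close>, and the vectors occurring in its gradient.
\<close>

definition separator ::
    "nat \<Rightarrow> (nat \<Rightarrow> 'a::real_inner set) \<Rightarrow> (nat \<Rightarrow> 'a \<Rightarrow> 'a) \<Rightarrow> (nat \<Rightarrow> 'a) \<Rightarrow> (nat \<Rightarrow> 'a) \<Rightarrow>
     'a \<Rightarrow> (nat \<Rightarrow> 'a) \<Rightarrow> real" where
  "separator n H G x y z w =
     (\<Sum>i=1..<n. inner (G i z - x i) (y i - w i)) +
     inner (G n z - x n) (y n + (\<Sum>i=1..<n. adjoint_on (H 0) (G i) (w i)))"

definition dual_residual ::
    "nat \<Rightarrow> (nat \<Rightarrow> 'a::real_inner set) \<Rightarrow> (nat \<Rightarrow> 'a \<Rightarrow> 'a) \<Rightarrow> (nat \<Rightarrow> 'a) \<Rightarrow> 'a" where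
  "dual_residual n H G y = (\<Sum>i=1..<n. adjoint_on (H 0) (G i) (y i)) + y n"

definition primal_residual ::
    "nat \<Rightarrow> (nat \<Rightarrow> 'a::real_inner \<Rightarrow> 'a) \<Rightarrow> (nat \<Rightarrow> 'a) \<Rightarrow> nat \<Rightarrow> 'a" where
  "primal_residual n G x i = x i - G i (x n)"

definition step_length ::
    "nat \<Rightarrow> (nat \<Rightarrow> 'a::real_inner set) \<Rightarrow> (nat \<Rightarrow> 'a \<Rightarrow> 'a) \<Rightarrow> real \<Rightarrow> (nat \<Rightarrow> 'a) \<Rightarrow> (nat \<Rightarrow> 'a) \<Rightarrow>
     'a \<Rightarrow> (nat \<Rightarrow> 'a) \<Rightarrow> real" where
  "step_length n H G \<gamma> x y z w =
     max 0 (separator n H G x y z w) /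
     (inverse \<gamma> * (norm (dual_residual n H G y))\<^sup>2 +
      (\<Sum>i=1..<n. (norm (primal_residual n G x i))\<^sup>2))"

text \<open>
  \<open>z k\<close>, \<open>w k i\<close>, \<open>x k i\<close>, \<open>y k i\<close>, \<open>e k i\<close>, \<open>\<rho> k i\<close>, \<open>\<alpha>s k\<close>, \<open>\<beta>s k\<close> are the quantities with iteration
  index \<open>k\<close> (and component index \<open>i\<close>) of an infinite run, that is, one that never meets the stopping
  criterion.  Truncated subtraction gives \<open>z (0 - 1) = z 0\<close> and \<open>w (0 - 1) = w 0\<close>, which is the
  prescribed initialization of the iterate with index \<open>-1\<close>.
\<close>

definition inertial_splitting_run ::
    "nat \<Rightarrow> (nat \<Rightarrow> 'a::real_inner set) \<Rightarrow> (nat \<Rightarrow> 'a \<Rightarrow> 'a set) \<Rightarrow> (nat \<Rightarrow> 'a \<Rightarrow> 'a) \<Rightarrow>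
     real \<Rightarrow> real \<Rightarrow> real \<Rightarrow> real \<Rightarrow> real \<Rightarrow>
     (nat \<Rightarrow> 'a) \<Rightarrow> (nat \<Rightarrow> nat \<Rightarrow> 'a) \<Rightarrow> (nat \<Rightarrow> nat \<Rightarrow> 'a) \<Rightarrow> (nat \<Rightarrow> nat \<Rightarrow> 'a) \<Rightarrow> (nat \<Rightarrow> nat \<Rightarrow> 'a) \<Rightarrow>
     (nat \<Rightarrow> nat \<Rightarrow> real) \<Rightarrow> (nat \<Rightarrow> real) \<Rightarrow> (nat \<Rightarrow> real) \<Rightarrow> bool" where
  "inertial_splitting_run n H T G \<alpha> \<sigma> \<beta>_lo \<beta>_hi \<gamma> z w x y e \<rho> \<alpha>s \<beta>s \<longleftrightarrow>
     0 \<le> \<alpha> \<and> \<alpha> < 1 \<and> 0 \<le> \<sigma> \<and> \<sigma> < 1 \<and> 0 < \<beta>_lo \<and> \<beta>_lo \<le> \<beta>_hi \<and> \<beta>_hi < 2 \<and> 0 < \<gamma> \<and>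
     (z 0, w 0) \<in> product_space n H \<and>
     (\<forall>k.
        let zh = z k + \<alpha>s k *\<^sub>R (z k - z (k - 1));
            wh = dual_extend n H G (\<lambda>i. w k i + \<alpha>s k *\<^sub>R (w k i - w (k - 1) i));
            \<theta> = step_length n H G \<gamma> (x k) (y k) zh wh
        in
          \<alpha>s k \<in> {0..\<alpha>} \<and>
          (\<forall>i\<in>{1..n}.
             \<rho> k i > 0 \<and> x k i \<in> H i \<and> e k i \<in> H i \<and>
             y k i \<in> T i (x k i) \<and>
             \<rho> k i *\<^sub>R y k i + x k i = G i zh + \<rho> k i *\<^sub>R wh i + e k i \<and>
             (norm (e k i))\<^sup>2 \<le>
               \<sigma>\<^sup>2 * ((norm (G i zh - x k i))\<^sup>2 + (norm (\<rho> k i *\<^sub>R (wh i - y k i)))\<^sup>2)) \<and>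
          \<not> ((\<forall>i\<in>{1..<n}. x k i = G i (x k n)) \<and>
             (\<Sum>i=1..<n. adjoint_on (H 0) (G i) (y k i)) + y k n = 0) \<and>
          \<beta>s k \<in> {\<beta>_lo..\<beta>_hi} \<and>
          z (Suc k) = zh - (inverse \<gamma> * \<beta>s k * \<theta>) *\<^sub>R dual_residual n H G (y k) \<and>
          (\<forall>i\<in>{1..<n}. w (Suc k) i = wh i - (\<beta>s k * \<theta>) *\<^sub>R primal_residual n G (x k) i))"

end

theory Submission
  imports Defs
begin

text \<open>
  The operators enter through the affine function \<open>separator\<close>, which is nonpositive on the extended
  solution set and, by the relative error criterion, bounded below at the extrapolated point by a
  multiple of the squared distances between that point and the trial points.  Each step is thus a
  relaxed projection onto a half-space containing the solution set, so it is Fejer monotone with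
  respect to the extrapolated point.  The choice of \<open>\<beta>_hi\<close> makes a Lyapunov function of
  Alvarez--Attouch type decrease strictly; hence the distance to each solution converges, consecutive
  differences vanish and so do all residuals.  Weak cluster points are then solutions by monotonicity
  and maximality, and Opial's argument gives weak convergence.

  Cluster points are taken along filters finer than \<open>sequentially\<close>.  They come from Tychonoff's
  theorem and the Riesz theorem, which avoids extracting subsequences in nonseparable spaces.
\<close>

section \<open>Weak cluster points in complete subspaces\<close>

text \<open>A relaxed projection with relaxation at most \<open>\<beta>_hi\<close> gains at least
  \<open>2 / \<beta>_hi - 1\<close> times the squared step, while extrapolation by \<open>a\<close>
  costs \<open>a * (1 + a)\<close> times the squared previous difference. Balancing gain against
  cost at the constant inertia \<open>\<alpha>_bar\<close> produces the formula for
  \<open>\<beta>_hi\<close>; the strict inequality \<open>\<alpha> < \<alpha>_bar\<close> leaves the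
  surplus that drives consecutive differences to zero. The obstacle at the limit is that inner
  products of two weakly convergent sequences need not converge. Only the sum over all components of
  the products of \<open>x\<close> and \<open>y\<close> is under control: it can be rewritten so
  that every product pairs a bounded factor with a residual vanishing in norm. Monotonicity
  therefore passes to the limit in summed form only, and the single inclusions must be recovered
  from maximality of the product of the operators.\<close>

lemma riesz_representation:
  fixes U :: "'a::real_inner set"
  assumes U: "hilbert_subspace U"
    and add: "\<And>u v. u \<in> U \<Longrightarrow> v \<in> U \<Longrightarrow> f (u + v) = f u + f v"
    and scale: "\<And>c u. u \<in> U \<Longrightarrow> f (c *\<^sub>R u) = c * f u"
    and bound: "\<And>u. u \<in> U \<Longrightarrow> \<bar>f u\<bar> \<le> K * norm u"
  obtains r where "r \<in> U" "\<And>u. u \<in> U \<Longrightarrow> f u = inner u r"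
proof -
  have sub: "subspace U" and comp: "complete U"
    using U by (auto simp: hilbert_subspace_def)
  \<comment> \<open>If \<open>r\<close> represents \<open>f\<close>, then \<open>J u\<close> is the
    squared distance from \<open>u\<close> to \<open>r\<close> minus the constant squared norm of
    \<open>r\<close>; the representer is thus sought as a minimizer of \<open>J\<close>.\<close>
  define J where "J u = (norm u)\<^sup>2 - 2 * f u" for u
  have J_lower: "- K\<^sup>2 \<le> J u" if "u \<in> U" for u
  proof -
    have "f u \<le> K * norm u"
      using bound[OF that] by linarith
    moreover have "0 \<le> (norm u - K)\<^sup>2"
      by simp
    ultimately show ?thesis
      by (simp add: J_def power2_eq_square algebra_simps)
  qed
  have bdd: "bdd_below (J ` U)"
    using J_lower by (auto intro!: bdd_belowI)
  have ne: "J ` U \<noteq> {}"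
    using subspace_0[OF sub] by auto
  define m where "m = Inf (J ` U)"
  have m_le: "m \<le> J u" if "u \<in> U" for u
    unfolding m_def using that bdd by (auto intro: cInf_lower)
  have "\<exists>u\<in>U. J u < m + 1 / Suc k" for k
    using cInf_lessD[OF ne, of "m + 1 / Suc k"] by (auto simp: m_def)
  then obtain u where u: "\<And>k. u k \<in> U" "\<And>k. J (u k) < m + 1 / Suc k"
    by metis
  \<comment> \<open>Parallelogram law: the linear part of \<open>J\<close> cancels at the midpoint,
    where \<open>J\<close> is still at least \<open>m\<close>. Hence minimizing sequences are
    Cauchy.\<close>
  have para: "(norm (a - b))\<^sup>2 \<le> 2 * (J a + J b - 2 * m)" if "a \<in> U" "b \<in> U" for a b
  proof -
    define c where "c = (1/2) *\<^sub>R (a + b)"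
    have c: "c \<in> U"
      unfolding c_def using that sub by (intro subspace_scale subspace_add)
    have "J a + J b - 2 * J c = (norm (a - b))\<^sup>2 / 2"
      using that subspace_add[OF sub that] add[OF that] scale[OF subspace_add[OF sub that], of "1/2"]
      by (simp del: scaleR_add_right scaleR_right_distrib add: c_def J_def power2_norm_eq_inner inner_add_left inner_add_right
          inner_diff_left inner_diff_right inner_commute power_mult_distrib field_simps)
    then have "(norm (a - b))\<^sup>2 = 2 * (J a + J b) - 4 * J c"
      by simp
    then show ?thesis
      using m_le[OF c] by simp
  qed
  have "Cauchy u"
  proof (rule metric_CauchyI)
    fix \<epsilon> :: real assume "0 < \<epsilon>"
    then obtain N where N: "1 / Suc N < \<epsilon>\<^sup>2 / 4"
      using nat_approx_posE[of "\<epsilon>\<^sup>2 / 4"] by auto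
    have "dist (u j) (u k) < \<epsilon>" if "N \<le> j" "N \<le> k" for j k
    proof -
      have "1 / Suc j \<le> 1 / Suc N" "1 / Suc k \<le> 1 / Suc N"
        using that by (auto intro!: divide_left_mono)
      then have "J (u j) + J (u k) - 2 * m < 2 * (\<epsilon>\<^sup>2 / 4)"
        using u(2)[of j] u(2)[of k] N by linarith
      then have "(norm (u j - u k))\<^sup>2 < \<epsilon>\<^sup>2"
        using para[OF u(1)[of j] u(1)[of k]] by simp
      then show ?thesis
        using \<open>0 < \<epsilon>\<close> by (auto simp: dist_norm intro: power2_less_imp_less)
    qed
    then show "\<exists>N. \<forall>j\<ge>N. \<forall>k\<ge>N. dist (u j) (u k) < \<epsilon>"
      by blast
  qed
  then obtain r where r: "r \<in> U" "u \<longlonglongrightarrow> r"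
    using comp u(1) by (auto simp: complete_def)
  have "(\<lambda>k. f (u k)) \<longlonglongrightarrow> f r"
  proof (rule LIM_zero_cancel, rule Lim_null_comparison)
    show "\<forall>\<^sub>F k in sequentially. norm (f (u k) - f r) \<le> K * norm (u k - r)"
    proof (intro always_eventually allI)
      fix k
      have "f (u k - r) = f (u k) - f r"
        using add[OF u(1)[of k] subspace_neg[OF sub r(1)]] scale[OF r(1), of "-1"] by simp
      then show "norm (f (u k) - f r) \<le> K * norm (u k - r)"
        using bound[OF subspace_diff[OF sub u(1)[of k] r(1)]] by simp
    qed
    have "(\<lambda>k. u k - r) \<longlonglongrightarrow> 0"
      using r(2) by (simp add: LIM_zero)
    then show "(\<lambda>k. K * norm (u k - r)) \<longlonglongrightarrow> 0"
      by (intro tendsto_mult_right_zero tendsto_norm_zero)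
  qed
  then have "(\<lambda>k. J (u k)) \<longlonglongrightarrow> J r"
    unfolding J_def using r(2) by (intro tendsto_intros)
  moreover have "(\<lambda>k. m + 1 / Suc k) \<longlonglongrightarrow> m + 0"
    using LIMSEQ_inverse_real_of_nat by (intro tendsto_intros) (simp add: inverse_eq_divide)
  ultimately have J_r: "J r \<le> m"
    using LIMSEQ_le[of "\<lambda>k. J (u k)" "J r" "\<lambda>k. m + 1 / Suc k" "m + 0"] u(2) less_imp_le by auto
  have "f v = inner v r" if v: "v \<in> U" for v
  proof -
    define d where "d = inner v r - f v"
    \<comment> \<open>First variation of \<open>J\<close> at its minimizer; evaluating at the vertex
      \<open>t = - d / N\<close> forces \<open>d = 0\<close>.\<close>
    have quad: "0 \<le> t\<^sup>2 * (norm v)\<^sup>2 + 2 * t * d" for t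
    proof -
      have tv: "t *\<^sub>R v \<in> U" "r + t *\<^sub>R v \<in> U"
        using v r(1) sub by (auto intro: subspace_scale subspace_add)
      have "(norm (r + t *\<^sub>R v))\<^sup>2 = (norm r)\<^sup>2 + t\<^sup>2 * (norm v)\<^sup>2 + 2 * t * inner v r"
        by (simp add: power2_norm_eq_inner inner_add_left inner_add_right inner_commute)
          (simp add: power2_eq_square)
      then have "J (r + t *\<^sub>R v) = J r + t\<^sup>2 * (norm v)\<^sup>2 + 2 * t * d"
        using r(1) tv v by (simp add: J_def d_def add scale algebra_simps)
      then show ?thesis
        using m_le[OF tv(2)] J_r by linarith
    qed
    show ?thesis
    proof (cases "v = 0")
      case True
      then show ?thesis
        using scale[OF v, of 0] by simp
    next
      case False
      define N where "N = (norm v)\<^sup>2"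
      have N: "0 < N"
        using False by (simp add: N_def)
      have "(- d / N)\<^sup>2 * N + 2 * (- d / N) * d = - (d\<^sup>2 / N)"
        using N by (simp add: power2_eq_square field_simps)
      with quad[of "- d / N"] have "d\<^sup>2 / N \<le> 0"
        by (simp add: N_def)
      then have "d = 0"
        using N by (simp add: divide_le_0_iff)
      then show ?thesis
        by (simp add: d_def)
    qed
  qed
  then show thesis
    using r(1) that by blast
qed

text \<open>Weak convergence of all components along one filter. Only the limit is required to lie
  in \<open>H i\<close>; membership of the sequence is established separately.\<close>

definition weakly_tends_to ::
    "'i set \<Rightarrow> ('i \<Rightarrow> 'a::real_inner set) \<Rightarrow> (nat \<Rightarrow> 'i \<Rightarrow> 'a) \<Rightarrow> ('i \<Rightarrow> 'a) \<Rightarrow> nat filter \<Rightarrow> bool" where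
  "weakly_tends_to I H P l F \<longleftrightarrow>
     (\<forall>i\<in>I. l i \<in> H i \<and> (\<forall>v\<in>H i. ((\<lambda>k. inner (P k i) v) \<longlongrightarrow> inner (l i) v) F))"

text \<open>Banach-Alaoglu for a whole family at once: the functionals of all components are
  coordinates of one point in a product of compact intervals, so a single filter serves every
  \<open>i\<close>. A cluster point of these functionals is linear and bounded in \<open>v\<close>,
  hence represented by a vector.\<close>

lemma weak_cluster_point:
  fixes H :: "'i \<Rightarrow> 'a::real_inner set"
  assumes H: "\<And>i. i \<in> I \<Longrightarrow> hilbert_subspace (H i)"
    and bounded: "\<And>i. i \<in> I \<Longrightarrow> bounded (range (\<lambda>k. P k i))"
    and F: "F \<noteq> bot"
  obtains F' l where "F' \<le> F" "F' \<noteq> bot" "weakly_tends_to I H P l F'"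
proof -
  obtain B where B: "\<And>i k. i \<in> I \<Longrightarrow> norm (P k i) \<le> B i"
    using bounded unfolding bounded_iff by (metis rangeI)
  \<comment> \<open>Outside \<open>I\<close> nothing is known about \<open>B i\<close>; the default
    value \<open>0\<close> and the absolute values in \<open>X\<close> keep \<open>g k\<close> in
    the compact box there as well.\<close>
  define g where "g k = (\<lambda>(i, v). if i \<in> I then inner (P k i) v else 0)" for k
  define X where "X = (\<lambda>(i, v). {- (\<bar>B i\<bar> * norm v)..\<bar>B i\<bar> * norm (v::'a)})"
  have "compactin (product_topology (\<lambda>_. euclidean) UNIV) (Pi\<^sub>E UNIV X)"
    by (auto simp: compactin_PiE X_def)
  then have compact: "compact (Pi\<^sub>E UNIV X)"
    by (simp add: euclidean_product_topology)
  have g_mem: "g k \<in> Pi\<^sub>E UNIV X" for k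
  proof -
    have "\<bar>inner (P k i) v\<bar> \<le> \<bar>B i\<bar> * norm v" if "i \<in> I" for i v
    proof -
      have "norm (P k i) * norm v \<le> \<bar>B i\<bar> * norm v"
        using B[OF that, of k] by (intro mult_right_mono) auto
      then show ?thesis
        using Cauchy_Schwarz_ineq2[of "P k i" v] by linarith
    qed
    then show ?thesis
      by (auto simp: g_def X_def abs_le_iff minus_le_iff PiE_def Pi_def)
  qed
  have "filtermap g F \<noteq> bot"
    using F by (simp add: filtermap_bot_iff)
  moreover have "\<forall>\<^sub>F f in filtermap g F. f \<in> Pi\<^sub>E UNIV X"
    using g_mem by (simp add: eventually_filtermap)
  ultimately obtain f where f: "f \<in> Pi\<^sub>E UNIV X" "inf (nhds f) (filtermap g F) \<noteq> bot"
    using compact unfolding compact_filter by blast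
  \<comment> \<open>The coarsest filter below \<open>F\<close> along which \<open>g\<close> tends to
    \<open>f\<close>; it is nontrivial because \<open>f\<close> is a cluster point of the image
    filter.\<close>
  define F' where "F' = inf F (filtercomap g (nhds f))"
  have F'_bot: "F' \<noteq> bot"
  proof
    assume "F' = bot"
    then have "eventually (\<lambda>_. False) F'"
      by simp
    then obtain Q R where "eventually Q F" "eventually R (filtercomap g (nhds f))"
      and QR: "\<And>k. Q k \<Longrightarrow> R k \<Longrightarrow> False"
      unfolding F'_def eventually_inf by blast
    moreover from this obtain S where "eventually S (nhds f)" and S: "\<And>k. S (g k) \<Longrightarrow> R k"
      by (auto simp: eventually_filtercomap)
    moreover have "eventually (\<lambda>a. \<not> S a) (filtermap g F)"
      unfolding eventually_filtermap using \<open>eventually Q F\<close>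
      by (rule eventually_mono) (use QR S in blast)
    ultimately have "eventually (\<lambda>_. False) (inf (nhds f) (filtermap g F))"
      unfolding eventually_inf by blast
    with f(2) show False
      by (simp add: trivial_limit_def)
  qed
  have "filterlim g (nhds f) F'"
    by (simp add: filterlim_iff_le_filtercomap F'_def)
  then have g_lim: "((\<lambda>k. g k a) \<longlongrightarrow> f a) F'" for a
    by (rule continuous_on_tendsto_compose[OF continuous_on_product_coordinates]) auto
  have lim: "((\<lambda>k. inner (P k i) v) \<longlongrightarrow> f (i, v)) F'" if "i \<in> I" for i v
    using g_lim[of "(i, v)"] that by (simp add: g_def)
  have "\<exists>r. r \<in> H i \<and> (\<forall>v\<in>H i. f (i, v) = inner v r)" if i: "i \<in> I" for i
  proof (rule riesz_representation[OF H[OF i], of "\<lambda>v. f (i, v)" "\<bar>B i\<bar>"])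
    show "f (i, u + v) = f (i, u) + f (i, v)" for u v
      using lim[OF i, of "u + v"] tendsto_add[OF lim[OF i, of u] lim[OF i, of v]]
      by (auto simp: inner_add_right intro: tendsto_unique[OF F'_bot])
    show "f (i, c *\<^sub>R u) = c * f (i, u)" for c u
      using lim[OF i, of "c *\<^sub>R u"] tendsto_mult_left[OF lim[OF i, of u], of c]
      by (auto intro: tendsto_unique[OF F'_bot])
    have "f (i, u) \<in> X (i, u)" for u
      using f(1) by blast
    then show "\<bar>f (i, u)\<bar> \<le> \<bar>B i\<bar> * norm u" for u
      by (auto simp: X_def abs_le_iff minus_le_iff)
  qed blast
  then obtain l where "\<And>i. i \<in> I \<Longrightarrow> l i \<in> H i" "\<And>i v. i \<in> I \<Longrightarrow> v \<in> H i \<Longrightarrow> f (i, v) = inner v (l i)"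
    by metis
  then have "weakly_tends_to I H P l F'"
    using lim unfolding weakly_tends_to_def by (metis inner_commute)
  moreover have "F' \<le> F"
    by (simp add: F'_def)
  ultimately show thesis
    using F'_bot that by blast
qed

section \<open>Inertial Fejer sequences\<close>

lemma geometric_recursion_tendsto_zero:
  fixes v :: "nat \<Rightarrow> real"
  assumes a: "0 \<le> a" "a < 1"
    and lim: "(\<lambda>k. v (Suc k) - a * v k) \<longlonglongrightarrow> 0"
  shows "v \<longlonglongrightarrow> 0"
proof (rule LIMSEQ_I)
  fix \<epsilon> :: real assume \<epsilon>: "0 < \<epsilon>"
  \<comment> \<open>Chosen so that \<open>\<epsilon> / 2\<close> is the fixed point of
    \<open>t \<mapsto> \<delta> + a * t\<close>.\<close>
  define \<delta> where "\<delta> = (1 - a) * (\<epsilon> / 2)"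
  have "0 < \<delta>"
    using \<epsilon> a by (simp add: \<delta>_def)
  then obtain N where N: "\<And>k. N \<le> k \<Longrightarrow> \<bar>v (Suc k) - a * v k\<bar> < \<delta>"
    using LIMSEQ_D[OF lim] by auto
  have le: "\<bar>v (N + m)\<bar> \<le> a ^ m * \<bar>v N\<bar> + \<epsilon> / 2" for m
  proof (induction m)
    case 0
    then show ?case using \<epsilon> by simp
  next
    case (Suc m)
    have "\<bar>v (N + Suc m)\<bar> \<le> \<bar>v (Suc (N + m)) - a * v (N + m)\<bar> + \<bar>a * v (N + m)\<bar>"
      by simp
    also have "\<dots> \<le> \<delta> + a * \<bar>v (N + m)\<bar>"
      using N[of "N + m"] a by (auto simp: abs_mult)
    also have "\<dots> \<le> \<delta> + a * (a ^ m * \<bar>v N\<bar> + \<epsilon> / 2)"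
      using Suc a by (intro add_left_mono mult_left_mono)
    also have "\<dots> = a ^ Suc m * \<bar>v N\<bar> + \<epsilon> / 2"
      by (simp add: \<delta>_def field_simps)
    finally show ?case .
  qed
  have "(\<lambda>m. a ^ m * \<bar>v N\<bar>) \<longlonglongrightarrow> 0"
    using a by (intro tendsto_mult_left_zero LIMSEQ_power_zero) auto
  then obtain M where M: "\<And>m. M \<le> m \<Longrightarrow> \<bar>a ^ m * \<bar>v N\<bar>\<bar> < \<epsilon> / 2"
    using LIMSEQ_D[of _ 0 "\<epsilon> / 2"] \<epsilon> by (metis diff_zero half_gt_zero real_norm_def)
  have "\<bar>v k\<bar> < \<epsilon>" if "N + M \<le> k" for k
  proof -
    from that have "\<bar>v k\<bar> \<le> a ^ (k - N) * \<bar>v N\<bar> + \<epsilon> / 2" "\<bar>a ^ (k - N) * \<bar>v N\<bar>\<bar> < \<epsilon> / 2"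
      using le[of "k - N"] M[of "k - N"] by auto
    then show ?thesis
      by linarith
  qed
  then show "\<exists>no. \<forall>k\<ge>no. norm (v k - 0) < \<epsilon>"
    by auto
qed

text \<open>Here \<open>h\<close> stands for the squared distance to a solution and \<open>d\<close>
  for the squared consecutive difference. The Lyapunov function \<open>\<mu>\<close> decreases but
  may be negative, so \<open>h\<close> is first bounded by a contraction argument. Since
  \<open>a\<close> increases to a limit below 1, convergence of \<open>\<mu>\<close> is then
  transferred back to \<open>h\<close>.\<close>

lemma inertial_recursion_convergent:
  fixes h d a :: "nat \<Rightarrow> real"
  assumes h: "\<And>k. 0 \<le> h k" and d: "\<And>k. 0 \<le> d k" and d_0: "d 0 = 0"
    and a: "\<And>k. 0 \<le> a k" "\<And>k. a k \<le> a (Suc k)" "\<And>k. a k \<le> \<alpha>" and \<alpha>: "\<alpha> < 1"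
    and \<eta>: "0 \<le> \<eta>" "\<alpha> * (1 + \<alpha>) < \<eta> * (1 - \<alpha>)\<^sup>2"
    and step: "\<And>k. h (Suc k) + \<eta> * ((1 - a k) * d (Suc k) - a k * (1 - a k) * d k)
                 \<le> (1 + a k) * h k - a k * h (k - 1) + a k * (1 + a k) * d k"
  shows "convergent h" "d \<longlonglongrightarrow> 0"
proof -
  \<comment> \<open>The total coefficient of \<open>d k\<close> once both its occurrences in
    \<open>step\<close> stand on the right.\<close>
  define \<delta> where "\<delta> k = a k * (1 + a k) + \<eta> * a k * (1 - a k)" for k
  define \<mu> where "\<mu> k = h k - a k * h (k - 1) + \<delta> k * d k" for k
  define \<epsilon> where "\<epsilon> = \<eta> * (1 - \<alpha>)\<^sup>2 - \<alpha> * (1 + \<alpha>)"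
  have \<epsilon>: "0 < \<epsilon>"
    using \<eta> by (simp add: \<epsilon>_def)
  have \<alpha>0: "0 \<le> \<alpha>"
    using a(1)[of 0] a(3)[of 0] by linarith
  have a1: "a k < 1" for k
    using a(3)[of k] \<alpha> by linarith
  \<comment> \<open>Monotonicity of \<open>a\<close> allows replacing \<open>a k\<close> by
    \<open>b = a (Suc k)\<close>; the right side then collapses to
    \<open>\<eta> * (1 - b)\<^sup>2 - b * (1 + b)\<close>, which is smallest at \<alpha>.\<close>
  have gap: "\<epsilon> \<le> \<eta> * (1 - a k) - \<delta> (Suc k)" for k
  proof -
    let ?b = "a (Suc k)"
    have "\<eta> * (1 - \<alpha>)\<^sup>2 \<le> \<eta> * (1 - ?b)\<^sup>2"
      using \<eta> a(3)[of "Suc k"] \<alpha> by (intro mult_left_mono power_mono) auto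
    moreover have "?b * (1 + ?b) \<le> \<alpha> * (1 + \<alpha>)"
      using a(1,3)[of "Suc k"] \<alpha>0 by (intro mult_mono) auto
    moreover have "\<eta> * (1 - ?b) \<le> \<eta> * (1 - a k)"
      using \<eta> a(2)[of k] by (intro mult_left_mono) auto
    ultimately show ?thesis
      by (simp add: \<epsilon>_def \<delta>_def power2_eq_square algebra_simps)
  qed
  have \<mu>_step: "\<mu> (Suc k) + \<epsilon> * d (Suc k) \<le> \<mu> k" for k
  proof -
    have "a k * h k \<le> a (Suc k) * h k"
      using a(2)[of k] h by (intro mult_right_mono)
    moreover have "\<epsilon> * d (Suc k) \<le> (\<eta> * (1 - a k) - \<delta> (Suc k)) * d (Suc k)"
      using gap d by (intro mult_right_mono)
    ultimately show ?thesis
      using step[of k] by (simp add: \<mu>_def \<delta>_def algebra_simps)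
  qed
  have \<mu>_dec: "decseq \<mu>"
  proof (rule decseq_SucI)
    show "\<mu> (Suc k) \<le> \<mu> k" for k
      using \<mu>_step[of k] mult_nonneg_nonneg[OF less_imp_le[OF \<epsilon>] d[of "Suc k"]] by linarith
  qed
  have \<delta>_nonneg: "0 \<le> \<delta> k" for k
    using a(1)[of k] a1[of k] \<eta> by (simp add: \<delta>_def)
  \<comment> \<open>The fixed point of \<open>t \<mapsto> h 0 + \<alpha> * t\<close>, and thus an
    invariant bound for \<open>h\<close>. The start uses that \<open>h (0 - 1)\<close> is
    \<open>h 0\<close> and that \<open>d 0 = 0\<close>.\<close>
  define M where "M = h 0 / (1 - \<alpha>)"
  have "\<mu> 0 = (1 - a 0) * h 0"
    by (simp add: \<mu>_def d_0 algebra_simps)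
  then have \<mu>_0: "\<mu> 0 \<le> h 0"
    using mult_nonneg_nonneg[OF a(1)[of 0] h[of 0]] by (simp add: algebra_simps)
  have M: "h 0 + \<alpha> * M = M"
    using \<alpha> by (simp add: M_def field_simps)
  have M0: "0 \<le> M"
    using h \<alpha> by (simp add: M_def)
  have \<alpha>M: "a k * u \<le> \<alpha> * M" if "u \<le> M" "0 \<le> u" for k u
    using a(1,3)[of k] that \<alpha>0 by (intro mult_mono)
  have h_le: "h k \<le> M" for k
  proof (induction k)
    case 0
    have "0 \<le> \<alpha> * M"
      using \<alpha>0 M0 by simp
    then show ?case
      using M by linarith
  next
    case (Suc k)
    have "\<mu> (Suc k) \<le> \<mu> 0"
      using \<mu>_dec by (auto simp: decseq_def)
    moreover have "0 \<le> \<delta> (Suc k) * d (Suc k)"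
      using \<delta>_nonneg d by simp
    ultimately have "h (Suc k) \<le> h 0 + a (Suc k) * h k"
      using \<mu>_0 by (simp add: \<mu>_def)
    then show ?case
      using \<alpha>M[OF Suc.IH h, of "Suc k"] M by linarith
  qed
  have "- (\<alpha> * M) \<le> \<mu> k" for k
    using h[of k] \<alpha>M[OF h_le h, of k "k - 1"] mult_nonneg_nonneg[OF \<delta>_nonneg d, of k k]
    by (simp add: \<mu>_def)
  then obtain L where L: "\<mu> \<longlonglongrightarrow> L"
    using decseq_convergent[OF \<mu>_dec] by metis
  have "(\<lambda>k. (\<mu> k - \<mu> (Suc k)) / \<epsilon>) \<longlonglongrightarrow> 0"
    using tendsto_diff[OF L LIMSEQ_Suc[OF L]] by (intro tendsto_divide_zero) simp
  moreover have "\<forall>k. norm (d (Suc k)) \<le> (\<mu> k - \<mu> (Suc k)) / \<epsilon>" for k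
    using \<mu>_step \<epsilon> d by (simp add: field_simps)
  ultimately have "(\<lambda>k. d (Suc k)) \<longlonglongrightarrow> 0"
    by (rule Lim_null_comparison[OF always_eventually, rotated])
  then show d_lim: "d \<longlonglongrightarrow> 0"
    by (rule LIMSEQ_imp_Suc)
  have "incseq a"
    using a(2) by (rule incseq_SucI)
  then obtain A where A: "a \<longlonglongrightarrow> A"
    using a(3) by (metis incseq_convergent)
  have A01: "0 \<le> A" "A < 1"
    using LIMSEQ_le_const[OF A, of 0] LIMSEQ_le_const2[OF A, of \<alpha>] a(1,3) \<alpha> by auto
  have "(\<lambda>k. \<delta> k * d k) \<longlonglongrightarrow> (A * (1 + A) + \<eta> * A * (1 - A)) * 0"
    unfolding \<delta>_def using A d_lim by (intro tendsto_intros)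
  then have "(\<lambda>k. \<mu> k - \<delta> k * d k) \<longlonglongrightarrow> L - 0"
    using L by (intro tendsto_diff) simp_all
  then have "(\<lambda>k. h (Suc k) - a (Suc k) * h k) \<longlonglongrightarrow> L"
    using LIMSEQ_Suc by (fastforce simp: \<mu>_def)
  \<comment> \<open>As \<open>h\<close> is bounded, the variable coefficient may be replaced by its
    limit \<open>A\<close>. Subtracting the fixed point \<open>l\<close> of
    \<open>t \<mapsto> A * t + L\<close> leaves a geometric recursion with vanishing
    forcing.\<close>
  moreover have "(\<lambda>k. (a (Suc k) - A) * h k) \<longlonglongrightarrow> 0"
  proof (rule Lim_null_comparison)
    show "\<forall>\<^sub>F k in sequentially. norm ((a (Suc k) - A) * h k) \<le> \<bar>a (Suc k) - A\<bar> * M"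
      using h h_le by (auto simp: abs_mult intro!: mult_left_mono always_eventually)
    show "(\<lambda>k. \<bar>a (Suc k) - A\<bar> * M) \<longlonglongrightarrow> 0"
      using LIMSEQ_Suc[OF A] by (intro tendsto_mult_left_zero tendsto_rabs_zero LIM_zero)
  qed
  ultimately have lim: "(\<lambda>k. (h (Suc k) - a (Suc k) * h k) + (a (Suc k) - A) * h k - L) \<longlonglongrightarrow> L + 0 - L"
    by (intro tendsto_intros)
  define l where "l = L / (1 - A)"
  have "(1 - A) * l = L"
    using A01 by (simp add: l_def)
  then have eq: "(h (Suc k) - l) - A * (h k - l) =
      (h (Suc k) - a (Suc k) * h k) + (a (Suc k) - A) * h k - L" for k
    by (simp add: algebra_simps)
  from lim have "(\<lambda>k. (h (Suc k) - l) - A * (h k - l)) \<longlonglongrightarrow> 0"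
    unfolding eq by simp
  from geometric_recursion_tendsto_zero[OF A01 this] show "convergent h"
    by (auto simp: convergent_def dest: LIM_zero_cancel)
qed

section \<open>Extrapolation in weighted products\<close>

lemma norm_extrapolation:
  fixes u v q :: "'a::real_inner"
  shows "(norm (u + a *\<^sub>R (u - v) - q))\<^sup>2 =
    (1 + a) * (norm (u - q))\<^sup>2 - a * (norm (v - q))\<^sup>2 + a * (1 + a) * (norm (u - v))\<^sup>2"
  by (simp add: power2_norm_eq_inner inner_add_left inner_add_right inner_diff_left
      inner_diff_right inner_commute algebra_simps)

text \<open>The two sides differ by exactly \<open>a * (norm ((p - u) - (u - v)))\<^sup>2\<close>.
  This converts the gain, measured from the extrapolated point, into consecutive
  differences.\<close>

lemma norm_extrapolation_ge:
  fixes p u v :: "'a::real_inner"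
  assumes "0 \<le> a"
  shows "(1 - a) * (norm (p - u))\<^sup>2 - a * (1 - a) * (norm (u - v))\<^sup>2
           \<le> (norm (p - (u + a *\<^sub>R (u - v))))\<^sup>2"
proof -
  have "0 \<le> a * (norm ((p - u) - (u - v)))\<^sup>2"
    using assms by simp
  then show ?thesis
    by (simp add: power2_norm_eq_inner inner_add_left inner_add_right inner_diff_left
        inner_diff_right inner_commute algebra_simps)
qed

lemma norm_extrapolation_le:
  fixes p u v :: "'a::real_inner"
  assumes "0 \<le> a" "a \<le> 1"
  shows "(norm (p - (u + a *\<^sub>R (u - v))))\<^sup>2 \<le> 2 * (norm (p - u))\<^sup>2 + 2 * (norm (u - v))\<^sup>2"
proof -
  have "norm (p - (u + a *\<^sub>R (u - v))) \<le> norm (p - u) + a * norm (u - v)"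
    using norm_triangle_ineq4[of "p - u" "a *\<^sub>R (u - v)"] assms by (simp add: diff_diff_eq)
  also have "a * norm (u - v) \<le> norm (u - v)"
    using assms by (simp add: mult_left_le_one_le)
  finally have "(norm (p - (u + a *\<^sub>R (u - v))))\<^sup>2 \<le> (norm (p - u) + norm (u - v))\<^sup>2"
    by (simp add: power_mono)
  moreover have "0 \<le> (norm (p - u) - norm (u - v))\<^sup>2"
    by simp
  ultimately show ?thesis
    by (simp add: power2_sum power2_diff)
qed

text \<open>The squared norm of a weighted direct sum, with points of the product space represented
  as indexed families.\<close>

definition sqnorm :: "'i set \<Rightarrow> ('i \<Rightarrow> real) \<Rightarrow> ('i \<Rightarrow> 'a::real_inner) \<Rightarrow> real" where
  "sqnorm I c p = (\<Sum>i\<in>I. c i * (norm (p i))\<^sup>2)"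

lemma sqnorm_nonneg: "(\<And>i. i \<in> I \<Longrightarrow> 0 \<le> c i) \<Longrightarrow> 0 \<le> sqnorm I c p"
  by (auto simp: sqnorm_def intro!: sum_nonneg)

lemma sqnorm_component_le:
  assumes "finite I" "\<And>i. i \<in> I \<Longrightarrow> 0 \<le> c i" "i \<in> I"
  shows "c i * (norm (p i))\<^sup>2 \<le> sqnorm I c p"
  unfolding sqnorm_def using assms
  by (intro member_le_sum[where f = "\<lambda>i. c i * (norm (p i))\<^sup>2"]) auto

lemma sqnorm_diff_scaled:
  "sqnorm I c (\<lambda>i. p i - t *\<^sub>R g i) =
     sqnorm I c p - 2 * t * (\<Sum>i\<in>I. c i * inner (g i) (p i)) + t\<^sup>2 * sqnorm I c g"
proof -
  have expand: "(norm (p i - t *\<^sub>R g i))\<^sup>2 =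
      (norm (p i))\<^sup>2 - 2 * t * inner (g i) (p i) + t\<^sup>2 * (norm (g i))\<^sup>2" for i
    by (simp add: power2_norm_eq_inner inner_diff_left inner_diff_right inner_commute)
      (simp add: power2_eq_square)
  show ?thesis
    unfolding sqnorm_def sum_distrib_left sum_subtractf[symmetric] sum.distrib[symmetric]
    by (intro sum.cong refl) (simp only: expand, simp add: algebra_simps)
qed

text \<open>Everything refers to one fixed \<open>q\<close>: a single solution already makes the
  steps vanish, while convergence of the distance is then available for each solution
  separately.\<close>

lemma inertial_fejer:
  fixes P Ph :: "nat \<Rightarrow> 'i \<Rightarrow> 'a::real_inner" and a :: "nat \<Rightarrow> real"
  assumes c: "\<And>i. i \<in> I \<Longrightarrow> 0 \<le> c i"
    and a: "\<And>k. 0 \<le> a k" "\<And>k. a k \<le> a (Suc k)" "\<And>k. a k \<le> \<alpha>" and \<alpha>: "\<alpha> < 1"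
    and \<eta>: "0 \<le> \<eta>" "\<alpha> * (1 + \<alpha>) < \<eta> * (1 - \<alpha>)\<^sup>2"
    and Ph: "\<And>k i. i \<in> I \<Longrightarrow> Ph k i = P k i + a k *\<^sub>R (P k i - P (k - 1) i)"
    and fejer: "\<And>k. sqnorm I c (\<lambda>i. P (Suc k) i - q i) + \<eta> * sqnorm I c (\<lambda>i. P (Suc k) i - Ph k i)
                      \<le> sqnorm I c (\<lambda>i. Ph k i - q i)"
  shows "convergent (\<lambda>k. sqnorm I c (\<lambda>i. P k i - q i))"
    and "(\<lambda>k. sqnorm I c (\<lambda>i. P k i - P (k - 1) i)) \<longlonglongrightarrow> 0"
    and "(\<lambda>k. sqnorm I c (\<lambda>i. P (Suc k) i - Ph k i)) \<longlonglongrightarrow> 0"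
proof -
  define h where "h k = sqnorm I c (\<lambda>i. P k i - q i)" for k
  define d where "d k = sqnorm I c (\<lambda>i. P k i - P (k - 1) i)" for k
  have h_nonneg: "0 \<le> h k" and d_nonneg: "0 \<le> d k" for k
    using c by (auto simp: h_def d_def intro: sqnorm_nonneg)
  have a1: "a k \<le> 1" for k
    using a(3)[of k] \<alpha> by linarith
  have Ph_q: "sqnorm I c (\<lambda>i. Ph k i - q i) =
      (1 + a k) * h k - a k * h (k - 1) + a k * (1 + a k) * d k" for k
    unfolding h_def d_def sqnorm_def sum_distrib_left sum_subtractf[symmetric] sum.distrib[symmetric]
    by (intro sum.cong refl) (simp only: Ph norm_extrapolation, simp add: algebra_simps)
  have P_Ph: "(1 - a k) * d (Suc k) - a k * (1 - a k) * d k \<le> sqnorm I c (\<lambda>i. P (Suc k) i - Ph k i)" for k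
  proof -
    have "(1 - a k) * d (Suc k) - a k * (1 - a k) * d k =
        (\<Sum>i\<in>I. c i * ((1 - a k) * (norm (P (Suc k) i - P k i))\<^sup>2
                          - a k * (1 - a k) * (norm (P k i - P (k - 1) i))\<^sup>2))"
      unfolding d_def sqnorm_def sum_distrib_left sum_subtractf[symmetric]
      by (intro sum.cong refl) (simp add: algebra_simps)
    also have "\<dots> \<le> sqnorm I c (\<lambda>i. P (Suc k) i - Ph k i)"
      unfolding sqnorm_def
      using c a(1) by (intro sum_mono mult_left_mono) (auto simp: Ph norm_extrapolation_ge)
    finally show ?thesis .
  qed
  have P_Ph_le: "sqnorm I c (\<lambda>i. P (Suc k) i - Ph k i) \<le> 2 * d (Suc k) + 2 * d k" for k
  proof -
    have "sqnorm I c (\<lambda>i. P (Suc k) i - Ph k i) \<le>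
        (\<Sum>i\<in>I. c i * (2 * (norm (P (Suc k) i - P k i))\<^sup>2 + 2 * (norm (P k i - P (k - 1) i))\<^sup>2))"
      unfolding sqnorm_def
      using c a(1) a1 by (intro sum_mono mult_left_mono) (auto simp: Ph norm_extrapolation_le)
    also have "\<dots> = 2 * d (Suc k) + 2 * d k"
      unfolding d_def sqnorm_def sum_distrib_left sum.distrib[symmetric]
      by (intro sum.cong refl) (simp add: algebra_simps)
    finally show ?thesis .
  qed
  have step: "h (Suc k) + \<eta> * ((1 - a k) * d (Suc k) - a k * (1 - a k) * d k)
      \<le> (1 + a k) * h k - a k * h (k - 1) + a k * (1 + a k) * d k" for k
    using fejer[of k] mult_left_mono[OF P_Ph[of k] \<eta>(1)] by (simp add: Ph_q h_def)
  have d_0: "d 0 = 0"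
    by (simp add: d_def sqnorm_def)
  note conv = inertial_recursion_convergent[where h = h and d = d and a = a and \<alpha> = \<alpha> and \<eta> = \<eta>,
      OF h_nonneg d_nonneg d_0 a \<alpha> \<eta> step]
  show "convergent (\<lambda>k. sqnorm I c (\<lambda>i. P k i - q i))"
    using conv(1) by (simp add: h_def[abs_def])
  show "(\<lambda>k. sqnorm I c (\<lambda>i. P k i - P (k - 1) i)) \<longlonglongrightarrow> 0"
    using conv(2) by (simp add: d_def[abs_def])
  show "(\<lambda>k. sqnorm I c (\<lambda>i. P (Suc k) i - Ph k i)) \<longlonglongrightarrow> 0"
  proof (rule Lim_null_comparison)
    show "\<forall>\<^sub>F k in sequentially. norm (sqnorm I c (\<lambda>i. P (Suc k) i - Ph k i)) \<le> 2 * d (Suc k) + 2 * d k"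
      using P_Ph_le c by (intro always_eventually) (simp add: sqnorm_nonneg)
    show "(\<lambda>k. 2 * d (Suc k) + 2 * d k) \<longlonglongrightarrow> 0"
      using LIMSEQ_Suc[OF conv(2)] conv(2) by (intro tendsto_add_zero tendsto_mult_right_zero)
  qed
qed

section \<open>From convergent distances to weak convergence\<close>

lemma sqnorm_convergent_imp_bounded:
  assumes "finite I" and c: "\<And>i. i \<in> I \<Longrightarrow> 0 < c i"
    and conv: "convergent (\<lambda>k. sqnorm I c (\<lambda>i. P k i - q i))" and i: "i \<in> I"
  shows "bounded (range (\<lambda>k. P k i :: 'a::real_inner))"
proof -
  have c_nonneg: "\<And>i. i \<in> I \<Longrightarrow> 0 \<le> c i"
    using c less_imp_le by blast
  obtain M where M: "\<And>k. \<bar>sqnorm I c (\<lambda>i. P k i - q i)\<bar> \<le> M"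
    using convergent_imp_Bseq[OF conv] by (auto simp: Bseq_def)
  have "norm (P k i) \<le> sqrt (M / c i) + norm (q i)" for k
  proof -
    have "c i * (norm (P k i - q i))\<^sup>2 \<le> M"
      using sqnorm_component_le[where c = c and p = "\<lambda>i. P k i - q i", OF \<open>finite I\<close> c_nonneg i] M[of k]
      by auto
    then have "norm (P k i - q i) \<le> sqrt (M / c i)"
      using c[OF i] by (intro real_le_rsqrt) (simp add: field_simps)
    then show ?thesis
      using norm_triangle_ineq[of "P k i - q i" "q i"] by simp
  qed
  then show ?thesis
    by (auto simp: bounded_iff)
qed

lemma opial:
  fixes H :: "'i \<Rightarrow> 'a::real_inner set" and P :: "nat \<Rightarrow> 'i \<Rightarrow> 'a"
  assumes I: "finite I" and H: "\<And>i. i \<in> I \<Longrightarrow> hilbert_subspace (H i)"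
    and c: "\<And>i. i \<in> I \<Longrightarrow> 0 < c i" and S: "S \<noteq> {}"
    and conv: "\<And>q. q \<in> S \<Longrightarrow> convergent (\<lambda>k. sqnorm I c (\<lambda>i. P k i - q i))"
    and cluster: "\<And>q F. F \<le> sequentially \<Longrightarrow> F \<noteq> bot \<Longrightarrow> weakly_tends_to I H P q F \<Longrightarrow> q \<in> S"
  obtains q where "q \<in> S" "weakly_tends_to I H P q sequentially"
proof -
  have c_nonneg: "\<And>i. i \<in> I \<Longrightarrow> 0 \<le> c i"
    using c less_imp_le by blast
  have bounded: "bounded (range (\<lambda>k. P k i))" if "i \<in> I" for i
    using S sqnorm_convergent_imp_bounded[OF I c conv that] by auto
  have unique: "q i = q' i"
    if F: "F \<le> sequentially" "F \<noteq> bot" "weakly_tends_to I H P q F"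
      and F': "F' \<le> sequentially" "F' \<noteq> bot" "weakly_tends_to I H P q' F'" and i: "i \<in> I"
    for q q' F F' i
  proof -
    have sub: "subspace (H j)" if "j \<in> I" for j
      using H[OF that] by (simp add: hilbert_subspace_def)
    have mem: "q' j - q j \<in> H j" if "j \<in> I" for j
      using F(3) F'(3) that subspace_diff[OF sub[OF that]] by (auto simp: weakly_tends_to_def)
    \<comment> \<open>The quadratic terms in \<open>P k\<close> cancel, so \<open>D\<close> is
      affine in \<open>P k\<close> and its limit can be evaluated along either filter. Comparing the
      values gives twice the squared distance between the two cluster points.\<close>
    define D where "D k = sqnorm I c (\<lambda>i. P k i - q i) - sqnorm I c (\<lambda>i. P k i - q' i)" for k
    define E where "E p = (\<Sum>i\<in>I. c i * (2 * inner (p i) (q' i - q i) + (norm (q i))\<^sup>2 - (norm (q' i))\<^sup>2))"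
      for p
    have D_E: "D k = E (P k)" for k
      unfolding D_def E_def sqnorm_def sum_subtractf[symmetric]
      by (intro sum.cong refl)
        (simp add: power2_norm_eq_inner inner_diff_left inner_diff_right inner_commute algebra_simps)
    have "q \<in> S" "q' \<in> S"
      using cluster F F' by blast+
    then obtain L where L: "D \<longlonglongrightarrow> L"
      unfolding D_def using convergent_diff[OF conv conv] by (auto simp: convergent_def)
    have "L = E r" if "F \<le> sequentially" "F \<noteq> bot" "weakly_tends_to I H P r F" for F r
    proof (rule tendsto_unique[OF that(2)])
      show "(D \<longlongrightarrow> L) F"
        using L that(1) by (rule tendsto_mono[rotated])
      show "(D \<longlongrightarrow> E r) F"
        unfolding D_E[abs_def] E_def using that(3) mem
        by (intro tendsto_sum tendsto_mult_left tendsto_add tendsto_diff tendsto_const)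
          (auto simp: weakly_tends_to_def)
    qed
    from this[OF F] this[OF F'] have "E q' - E q = 0"
      by simp
    moreover have "E q' - E q = 2 * sqnorm I c (\<lambda>i. q' i - q i)"
      unfolding E_def sqnorm_def sum_distrib_left sum_subtractf[symmetric]
      by (intro sum.cong refl)
        (simp add: power2_norm_eq_inner inner_diff_left inner_diff_right inner_commute algebra_simps)
    ultimately have "c i * (norm (q' i - q i))\<^sup>2 \<le> 0"
      using sqnorm_component_le[where c = c and p = "\<lambda>i. q' i - q i", OF I c_nonneg i] by auto
    then show "q i = q' i"
      using c[OF i] by (simp add: mult_le_0_iff)
  qed
  obtain F q where F: "F \<le> sequentially" "F \<noteq> bot" and q: "weakly_tends_to I H P q F"
    using weak_cluster_point[where I = I and H = H and P = P and F = sequentially, OF H bounded] by auto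
  have "(\<lambda>k. inner (P k i) v) \<longlonglongrightarrow> inner (q i) v" if i: "i \<in> I" and v: "v \<in> H i" for i v
  proof (rule ccontr)
    assume "\<not> ?thesis"
    then obtain \<epsilon> where \<epsilon>: "0 < \<epsilon>"
      and not_ev: "\<not> (\<forall>\<^sub>F k in sequentially. dist (inner (P k i) v) (inner (q i) v) < \<epsilon>)"
      by (auto simp: tendsto_iff)
    \<comment> \<open>Filter counterpart of a subsequence staying \<open>\<epsilon>\<close> away
      from the claimed limit; a cluster point along it contradicts uniqueness.\<close>
    define F0 where "F0 = inf sequentially (principal {k. \<epsilon> \<le> dist (inner (P k i) v) (inner (q i) v)})"
    have "F0 \<noteq> bot"
      using not_ev by (simp add: F0_def trivial_limit_def eventually_inf_principal not_le)
    then obtain F1 q1 where F1: "F1 \<le> F0" "F1 \<noteq> bot" and q1: "weakly_tends_to I H P q1 F1"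
      using weak_cluster_point[where I = I and H = H and P = P and F = F0, OF H bounded] by blast
    have "F1 \<le> sequentially"
      using F1(1) by (simp add: F0_def)
    then have "q i = q1 i"
      using unique[OF F q _ F1(2) q1 i] by blast
    then have "\<forall>\<^sub>F k in F1. dist (inner (P k i) v) (inner (q i) v) < \<epsilon>"
      using q1 i v \<epsilon> by (auto simp: weakly_tends_to_def tendsto_iff)
    moreover have "\<forall>\<^sub>F k in F1. \<epsilon> \<le> dist (inner (P k i) v) (inner (q i) v)"
      by (rule filter_leD[OF F1(1)]) (simp add: F0_def eventually_inf_principal)
    ultimately have "\<forall>\<^sub>F k in F1. False"
      by eventually_elim simp
    with F1(2) show False
      by simp
  qed
  then have "weakly_tends_to I H P q sequentially"
    using q by (auto simp: weakly_tends_to_def)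
  with cluster[OF F q] that show thesis
    by blast
qed

section \<open>Monotone inclusions and the separator\<close>

text \<open>Adding the pair \<open>(a, b)\<close> to the graph keeps it monotone, so by maximality
  the pair was already there.\<close>

lemma maximal_monotoneD:
  assumes T: "maximal_monotone U T" and "a \<in> U" "b \<in> U"
    and rel: "\<And>u v. u \<in> U \<Longrightarrow> v \<in> T u \<Longrightarrow> 0 \<le> inner (a - u) (b - v)"
  shows "b \<in> T a"
proof -
  define T' where "T' = T(a := insert b (T a))"
  have "inner (u - a) (v - b) = inner (a - u) (b - v)" for u v
    by (simp add: inner_diff_left inner_diff_right)
  then have "monotone_operator U T'"
    using T assms(2,3) rel
    by (auto simp: T'_def maximal_monotone_def monotone_operator_def split: if_splits)
  moreover have "operator_graph U T \<subseteq> operator_graph U T'"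
    by (auto simp: operator_graph_def T'_def)
  ultimately have "operator_graph U T' = operator_graph U T"
    using T by (auto simp: maximal_monotone_def)
  moreover have "(a, b) \<in> operator_graph U T'"
    using \<open>a \<in> U\<close> by (simp add: operator_graph_def T'_def)
  ultimately show ?thesis
    by (simp add: operator_graph_def)
qed

text \<open>
  If component \<open>j\<close> failed, maximality would give a point of the graph with a negative \<open>j\<close>-th term,
  while in every other component the term can be made nonpositive.
\<close>

lemma maximal_monotone_product:
  assumes I: "finite I" and T: "\<And>i. i \<in> I \<Longrightarrow> maximal_monotone (U i) (T i)"
    and mem: "\<And>i. i \<in> I \<Longrightarrow> a i \<in> U i \<and> b i \<in> U i"
    and rel: "\<And>u v. (\<And>i. i \<in> I \<Longrightarrow> u i \<in> U i \<and> v i \<in> T i (u i)) \<Longrightarrow>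
                0 \<le> (\<Sum>i\<in>I. inner (a i - u i) (b i - v i))"
    and j: "j \<in> I"
  shows "b j \<in> T j (a j)"
proof (rule ccontr)
  assume not: "b j \<notin> T j (a j)"
  have neg: "\<exists>u v. u \<in> U i \<and> v \<in> T i u \<and> inner (a i - u) (b i - v) < 0"
    if "i \<in> I" "b i \<notin> T i (a i)" for i
    using maximal_monotoneD[OF T[OF that(1)], of "a i" "b i"] mem that not_le by blast
  have "\<exists>u v. u \<in> U i \<and> v \<in> T i u \<and> inner (a i - u) (b i - v) \<le> 0 \<and>
          (b i \<notin> T i (a i) \<longrightarrow> inner (a i - u) (b i - v) < 0)" if "i \<in> I" for i
  proof (cases "b i \<in> T i (a i)")
    case True
    then show ?thesis
      using mem[OF that] by (intro exI[of _ "a i"] exI[of _ "b i"]) auto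
  next
    case False
    then show ?thesis
      using neg[OF that] less_imp_le by blast
  qed
  then obtain u v where uv: "\<And>i. i \<in> I \<Longrightarrow> u i \<in> U i \<and> v i \<in> T i (u i)"
      "\<And>i. i \<in> I \<Longrightarrow> inner (a i - u i) (b i - v i) \<le> 0"
      "\<And>i. i \<in> I \<Longrightarrow> b i \<notin> T i (a i) \<Longrightarrow> inner (a i - u i) (b i - v i) < 0"
    by metis
  have "(\<Sum>i\<in>I. inner (a i - u i) (b i - v i)) < (\<Sum>i\<in>I. 0)"
    using I uv(2,3) j not by (intro sum_strict_mono2 sum_strict_mono_ex1) auto
  with rel[of u v] uv(1) show False
    by simp
qed

lemma tendsto_inner_bounded_null:
  fixes a b :: "'k \<Rightarrow> 'a::real_inner"
  assumes "bounded (range a)" and b: "(b \<longlongrightarrow> 0) F"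
  shows "((\<lambda>k. inner (a k) (b k)) \<longlongrightarrow> 0) F"
proof -
  obtain B where B: "\<And>k. norm (a k) \<le> B"
    using assms(1) by (auto simp: bounded_iff)
  show ?thesis
  proof (rule Lim_null_comparison)
    have "norm (inner (a k) (b k)) \<le> B * norm (b k)" for k
      using Cauchy_Schwarz_ineq2[of "a k" "b k"] mult_right_mono[OF B[of k], of "norm (b k)"]
      by simp
    then show "\<forall>\<^sub>F k in F. norm (inner (a k) (b k)) \<le> B * norm (b k)"
      by simp
    show "((\<lambda>k. B * norm (b k)) \<longlongrightarrow> 0) F"
      using b by (intro tendsto_mult_right_zero tendsto_norm_zero)
  qed
qed

section \<open>The composite inclusion and the adjoints of its linear maps\<close>

locale splitting_problem =
  fixes n :: nat
    and H :: "nat \<Rightarrow> 'a::real_inner set"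
    and T :: "nat \<Rightarrow> 'a \<Rightarrow> 'a set"
    and G :: "nat \<Rightarrow> 'a \<Rightarrow> 'a"
  assumes n: "2 \<le> n"
    and H: "\<And>i. i \<in> {0..n} \<Longrightarrow> hilbert_subspace (H i)"
    and H_n: "H 0 = H n"
    and T: "\<And>i. i \<in> {1..n} \<Longrightarrow> maximal_monotone (H i) (T i)"
    and G: "\<And>i. i \<in> {1..n} \<Longrightarrow> bounded_linear_between (H 0) (H i) (G i)"
    and G_n: "\<And>u. u \<in> H 0 \<Longrightarrow> G n u = u"
begin

abbreviation adj :: "nat \<Rightarrow> 'a \<Rightarrow> 'a" where
  "adj i \<equiv> adjoint_on (H 0) (G i)"

abbreviation ext :: "(nat \<Rightarrow> 'a) \<Rightarrow> nat \<Rightarrow> 'a" where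
  "ext \<equiv> dual_extend n H G"

lemma H_subspace: "i \<in> {0..n} \<Longrightarrow> subspace (H i)"
  using H by (simp add: hilbert_subspace_def)

lemma H0_subspace: "subspace (H 0)"
  by (simp add: H_subspace)

lemma G_mem: "i \<in> {1..n} \<Longrightarrow> u \<in> H 0 \<Longrightarrow> G i u \<in> H i"
  and G_add: "i \<in> {1..n} \<Longrightarrow> u \<in> H 0 \<Longrightarrow> v \<in> H 0 \<Longrightarrow> G i (u + v) = G i u + G i v"
  and G_scale: "i \<in> {1..n} \<Longrightarrow> u \<in> H 0 \<Longrightarrow> G i (c *\<^sub>R u) = c *\<^sub>R G i u"
  using G by (auto simp: bounded_linear_between_def)

lemma G_diff:
  assumes "i \<in> {1..n}" "u \<in> H 0" "v \<in> H 0"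
  shows "G i (u - v) = G i u - G i v"
  using G_add[OF assms(1,2) subspace_neg[OF H0_subspace assms(3)]] G_scale[OF assms(1,3), of "-1"]
  by simp

lemma G_uniform_bound:
  obtains K where "1 \<le> K" "\<And>i u. i \<in> {1..n} \<Longrightarrow> u \<in> H 0 \<Longrightarrow> norm (G i u) \<le> K * norm u"
proof -
  have "\<forall>i\<in>{1..n}. \<exists>K. \<forall>u\<in>H 0. norm (G i u) \<le> K * norm u"
    using G by (auto simp: bounded_linear_between_def)
  then obtain k where k: "\<And>i u. i \<in> {1..n} \<Longrightarrow> u \<in> H 0 \<Longrightarrow> norm (G i u) \<le> k i * norm u"
    by metis
  \<comment> \<open>The summand 1 lets the same constant dominate the term of index \<open>n\<close>
    that carries no adjoint in the dual residual.\<close>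
  define K where "K = 1 + (\<Sum>i=1..n. \<bar>k i\<bar>)"
  have "k i \<le> K" if "i \<in> {1..n}" for i
    using member_le_sum[OF that, of "\<lambda>i. \<bar>k i\<bar>"] by (simp add: K_def)
  then have "norm (G i u) \<le> K * norm u" if "i \<in> {1..n}" "u \<in> H 0" for i u
    using k[OF that] mult_right_mono[of "k i" K "norm u"] that(1) by fastforce
  moreover have "1 \<le> K"
    by (simp add: K_def sum_nonneg)
  ultimately show thesis
    using that by blast
qed

text \<open>The functional to be represented is bounded on \<open>H 0\<close> for every ambient
  \<open>v\<close>, not just for \<open>v\<close> in \<open>H i\<close>; hence \<open>adj i\<close>
  is defined, and later linear, on the whole type.\<close>

lemma adj_props:
  assumes i: "i \<in> {1..n}"
  shows adj_mem: "adj i v \<in> H 0"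
    and inner_adj: "\<And>u. u \<in> H 0 \<Longrightarrow> inner (G i u) v = inner u (adj i v)"
    and adj_eqI: "\<And>r. r \<in> H 0 \<Longrightarrow> (\<And>u. u \<in> H 0 \<Longrightarrow> inner (G i u) v = inner u r) \<Longrightarrow> adj i v = r"
proof -
  obtain K where K: "\<And>i u. i \<in> {1..n} \<Longrightarrow> u \<in> H 0 \<Longrightarrow> norm (G i u) \<le> K * norm u"
    using G_uniform_bound by blast
  let ?Q = "\<lambda>r. r \<in> H 0 \<and> (\<forall>u\<in>H 0. inner (G i u) v = inner u r)"
  have "\<exists>r. ?Q r"
  proof (rule riesz_representation[of "H 0" "\<lambda>u. inner (G i u) v" "K * norm v"])
    show "hilbert_subspace (H 0)"
      using H by simp
    fix u assume u: "u \<in> H 0"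
    have "norm (G i u) * norm v \<le> K * norm u * norm v"
      using K[OF i u] by (rule mult_right_mono) simp
    then show "\<bar>inner (G i u) v\<bar> \<le> K * norm v * norm u"
      using Cauchy_Schwarz_ineq2[of "G i u" v] by (simp add: mult_ac)
    show "inner (G i (c *\<^sub>R u)) v = c * inner (G i u) v" for c
      using G_scale[OF i u] by simp
    show "inner (G i (u + u')) v = inner (G i u) v + inner (G i u') v" if "u' \<in> H 0" for u'
      using G_add[OF i u that] by (simp add: inner_add_left)
  qed blast
  moreover have unique: "r = r'" if "?Q r" "?Q r'" for r r'
  proof -
    have "r - r' \<in> H 0"
      using that subspace_diff[OF H0_subspace] by blast
    then have "inner (r - r') (r - r') = 0"
      using that by (simp add: inner_diff_right)
    then show ?thesis
      by simp
  qed
  ultimately have "\<exists>!r. ?Q r"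
    by blast
  then have Q: "?Q (adj i v)"
    unfolding adjoint_on_def by (rule theI')
  then show "adj i v \<in> H 0" "\<And>u. u \<in> H 0 \<Longrightarrow> inner (G i u) v = inner u (adj i v)"
    by blast+
  show "\<And>r. r \<in> H 0 \<Longrightarrow> (\<And>u. u \<in> H 0 \<Longrightarrow> inner (G i u) v = inner u r) \<Longrightarrow> adj i v = r"
    using unique[OF Q] by blast
qed

lemma adj_linear:
  assumes i: "i \<in> {1..n}"
  shows "linear (adj i)"
proof (rule linearI)
  note [intro] = adj_mem[OF i] subspace_add[OF H0_subspace] subspace_scale[OF H0_subspace]
  show "adj i (u + v) = adj i u + adj i v" for u v
    by (rule adj_eqI[OF i]) (auto simp: inner_adj[OF i] inner_add_right)
  show "adj i (c *\<^sub>R v) = c *\<^sub>R adj i v" for c v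
    by (rule adj_eqI[OF i]) (auto simp: inner_adj[OF i])
qed

lemma adj_n: "v \<in> H 0 \<Longrightarrow> adj n v = v"
  using n by (intro adj_eqI) (auto simp: G_n)

lemma adj_norm_le:
  assumes i: "i \<in> {1..n}" and "0 \<le> K" and K: "\<And>u. u \<in> H 0 \<Longrightarrow> norm (G i u) \<le> K * norm u"
  shows "norm (adj i v) \<le> K * norm v"
proof (cases "adj i v = 0")
  case True
  then show ?thesis
    using \<open>0 \<le> K\<close> by simp
next
  case False
  have "norm (adj i v) * norm (adj i v) = inner (G i (adj i v)) v"
    using inner_adj[OF i adj_mem[OF i], of v v]
    by (simp add: power2_norm_eq_inner[symmetric] power2_eq_square)
  also have "\<dots> \<le> norm (G i (adj i v)) * norm v"
    by (rule norm_cauchy_schwarz)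
  also have "\<dots> \<le> K * norm (adj i v) * norm v"
    using K[OF adj_mem[OF i]] by (rule mult_right_mono) simp
  finally have "norm (adj i v) * norm (adj i v) \<le> norm (adj i v) * (K * norm v)"
    by (simp add: mult_ac)
  then show ?thesis
    using False by simp
qed

section \<open>Separator and residuals\<close>

lemma sum_last: "(\<Sum>i=1..n. f i) = (\<Sum>i=1..<n. f i) + (f n :: 'b::comm_monoid_add)"
proof -
  have "{1..n} = insert n {1..<n}"
    using n by auto
  then show ?thesis
    by (simp add: add.commute)
qed

lemma ext_less: "i \<in> {1..<n} \<Longrightarrow> ext w i = w i"
  and ext_last: "ext w n = - (\<Sum>j=1..<n. adj j (w j))"
  by (auto simp: dual_extend_def)

lemma ext_mem:
  assumes w: "\<And>i. i \<in> {1..<n} \<Longrightarrow> w i \<in> H i" and i: "i \<in> {1..n}"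
  shows "ext w i \<in> H i"
proof (cases "i = n")
  case True
  have "- (\<Sum>j=1..<n. adj j (w j)) \<in> H 0"
    by (intro subspace_neg subspace_sum H0_subspace adj_mem) auto
  then show ?thesis
    using True by (simp add: ext_last H_n)
next
  case False
  then show ?thesis
    using w i by (simp add: ext_less)
qed

text \<open>The component \<open>n\<close> of \<open>ext w\<close> is designed to cancel the others
  after moving each \<open>G i\<close> to the adjoint. This removes the bilinear part of the
  separator and reappears as the identity satisfied by weak limits.\<close>

lemma ext_orthogonal:
  assumes "u \<in> H 0"
  shows "(\<Sum>i=1..n. inner (G i u) (ext w i)) = 0"
proof -
  have "(\<Sum>i=1..<n. inner (G i u) (ext w i)) = inner u (\<Sum>i=1..<n. adj i (w i))"
    unfolding inner_sum_right using assms by (intro sum.cong refl) (simp add: ext_less inner_adj)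
  then show ?thesis
    unfolding sum_last using assms by (simp add: ext_last G_n)
qed

lemma solution_iff:
  "(u, v) \<in> extended_solution_set n H T G \<longleftrightarrow>
     u \<in> H 0 \<and> (\<forall>i\<in>{1..<n}. v i \<in> H i) \<and> (\<forall>i\<in>{1..n}. ext v i \<in> T i (G i u))"
proof -
  have "{1..n} = insert n {1..<n}"
    using n by auto
  then show ?thesis
    by (auto simp: extended_solution_set_def product_space_def Pi_def ext_less ext_last G_n)
qed

lemma separator_eq_sum:
  assumes "u \<in> H 0"
  shows "separator n H G x y u w = (\<Sum>i=1..n. inner (G i u - x i) (y i - ext w i))"
  unfolding separator_def sum_last by (simp add: ext_less ext_last)

text \<open>Subtracting \<open>G i (x n)\<close> from each \<open>x i\<close> leaves the primal
  residuals, and the subtracted terms assemble into the dual residual. When both residuals vanish in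
  norm, this controls a sum of products of merely weakly convergent factors.\<close>

lemma sum_inner_residual:
  assumes "x n \<in> H 0"
  shows "(\<Sum>i=1..n. inner (x i) (y i)) =
    inner (x n) (dual_residual n H G y) + (\<Sum>i=1..<n. inner (primal_residual n G x i) (y i))"
proof -
  have "inner (x n) (dual_residual n H G y) = (\<Sum>i=1..<n. inner (G i (x n)) (y i)) + inner (x n) (y n)"
    using assms by (simp add: dual_residual_def inner_add_right inner_sum_right inner_adj)
  then show ?thesis
    unfolding sum_last by (simp add: primal_residual_def inner_diff_left sum_subtractf)
qed

lemma separator_affine:
  assumes u: "u \<in> H 0" and x: "x n \<in> H 0"
  shows "separator n H G x y u w = inner u (dual_residual n H G y)
    + (\<Sum>i=1..<n. inner (primal_residual n G x i) (w i)) - (\<Sum>i=1..n. inner (x i) (y i))"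
proof -
  have "separator n H G x y u w =
      (\<Sum>i=1..n. inner (G i u) (y i)) - (\<Sum>i=1..n. inner (G i u) (ext w i))
      - (\<Sum>i=1..n. inner (x i) (y i)) + (\<Sum>i=1..n. inner (x i) (ext w i))"
    using u by (simp add: separator_eq_sum inner_diff_left inner_diff_right sum_subtractf)
  moreover have "(\<Sum>i=1..n. inner (G i u) (y i)) = inner u (dual_residual n H G y)"
    unfolding sum_last using u
    by (simp add: dual_residual_def inner_add_right inner_sum_right inner_adj G_n)
  \<comment> \<open>With \<open>y = ext w\<close>, only the primal residuals survive in
    \<open>sum_inner_residual\<close>; the separator thereby shows its gradient, the dual residual
    in \<open>u\<close> and the primal residuals in \<open>w\<close>.\<close>
  moreover have "dual_residual n H G (ext w) = 0"
    by (simp add: dual_residual_def ext_less ext_last)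
  then have "(\<Sum>i=1..n. inner (x i) (ext w i)) = (\<Sum>i=1..<n. inner (primal_residual n G x i) (w i))"
    using sum_inner_residual[where x = x and y = "ext w", OF x] by (simp add: ext_less)
  ultimately show ?thesis
    using ext_orthogonal[OF u] by simp
qed

lemma separator_nonpos:
  assumes sol: "(u, v) \<in> extended_solution_set n H T G"
    and xy: "\<And>i. i \<in> {1..n} \<Longrightarrow> x i \<in> H i \<and> y i \<in> T i (x i)"
  shows "separator n H G x y u v \<le> 0"
proof -
  have u: "u \<in> H 0" and v: "\<And>i. i \<in> {1..n} \<Longrightarrow> ext v i \<in> T i (G i u)"
    using sol by (auto simp: solution_iff)
  have "inner (G i u - x i) (y i - ext v i) \<le> 0" if i: "i \<in> {1..n}" for i
  proof -
    have "0 \<le> inner (G i u - x i) (ext v i - y i)"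
      using T[OF i] xy[OF i] v[OF i] G_mem[OF i u]
      by (auto simp: maximal_monotone_def monotone_operator_def)
    then show ?thesis
      by (simp add: inner_diff_right)
  qed
  then show ?thesis
    using u by (auto simp: separator_eq_sum intro: sum_nonpos)
qed

text \<open>The residuals vanish if \<open>x i = G i u\<close> and \<open>y i = ext w i\<close>, and
  depend linearly on the deviations from that case. The constant is uniform in all points, which
  later keeps the projection steps from being short while the trial points are far away.\<close>

lemma residual_bound:
  assumes \<gamma>: "0 < \<gamma>"
  obtains C where "0 < C"
    "\<And>x y u w. u \<in> H 0 \<Longrightarrow> x n \<in> H 0 \<Longrightarrow>
       inverse \<gamma> * (norm (dual_residual n H G y))\<^sup>2 + (\<Sum>i=1..<n. (norm (primal_residual n G x i))\<^sup>2)
       \<le> C * (\<Sum>i=1..n. (norm (G i u - x i))\<^sup>2 + (norm (y i - ext w i))\<^sup>2)"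
proof -
  obtain K where K1: "1 \<le> K" and K: "\<And>i u. i \<in> {1..n} \<Longrightarrow> u \<in> H 0 \<Longrightarrow> norm (G i u) \<le> K * norm u"
    using G_uniform_bound by blast
  define C where "C = inverse \<gamma> * (K\<^sup>2 * n) + (2 + 2 * K\<^sup>2 * n)"
  have "0 < C"
    unfolding C_def using \<gamma> by (intro add_nonneg_pos add_pos_nonneg mult_nonneg_nonneg) auto
  moreover
  have "inverse \<gamma> * (norm (dual_residual n H G y))\<^sup>2 + (\<Sum>i=1..<n. (norm (primal_residual n G x i))\<^sup>2)
       \<le> C * (\<Sum>i=1..n. (norm (G i u - x i))\<^sup>2 + (norm (y i - ext w i))\<^sup>2)"
    if u: "u \<in> H 0" and x: "x n \<in> H 0" for x y u w
  proof -
    define A where "A = (\<Sum>i=1..n. (norm (G i u - x i))\<^sup>2)"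
    define B where "B = (\<Sum>i=1..n. (norm (y i - ext w i))\<^sup>2)"
    have A0: "0 \<le> A" and B0: "0 \<le> B"
      by (auto simp: A_def B_def intro: sum_nonneg)
    have "norm (dual_residual n H G y) \<le> K * (\<Sum>i=1..n. norm (y i - ext w i))"
    proof -
      \<comment> \<open>Subtracting \<open>ext w\<close> changes nothing, because its own dual
        residual is zero.\<close>
      have "dual_residual n H G y = (\<Sum>i=1..<n. adj i (y i - ext w i)) + (y n - ext w n)"
        by (simp add: dual_residual_def ext_less ext_last linear_diff[OF adj_linear] sum_subtractf)
      also have "norm \<dots> \<le> (\<Sum>i=1..<n. norm (adj i (y i - ext w i))) + norm (y n - ext w n)"
        by (rule order_trans[OF norm_triangle_ineq add_right_mono[OF norm_sum]])
      also have "\<dots> \<le> (\<Sum>i=1..<n. K * norm (y i - ext w i)) + K * norm (y n - ext w n)"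
        using K K1 mult_right_mono[OF K1, of "norm (y n - ext w n)"]
        by (intro add_mono sum_mono adj_norm_le) auto
      finally show ?thesis
        unfolding sum_last by (simp add: sum_distrib_left distrib_left)
    qed
    then have "(norm (dual_residual n H G y))\<^sup>2 \<le> (K * (\<Sum>i=1..n. norm (y i - ext w i)))\<^sup>2"
      by (simp add: power_mono)
    also have "\<dots> \<le> K\<^sup>2 * (B * n)"
      using sum_squared_le_sum_of_squares[of "\<lambda>i. norm (y i - ext w i)" "{1..n}"]
      by (simp add: power_mult_distrib B_def mult_left_mono)
    finally have dual: "inverse \<gamma> * (norm (dual_residual n H G y))\<^sup>2 \<le> inverse \<gamma> * (K\<^sup>2 * n) * B"
      using mult_left_mono[of _ _ "inverse \<gamma>"] \<gamma> by (simp add: mult_ac)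
    have A_n: "(norm (u - x n))\<^sup>2 \<le> A"
      unfolding A_def using u n
      by (intro member_le_sum[of n, where f = "\<lambda>i. (norm (G i u - x i))\<^sup>2", simplified, THEN order_trans[rotated]])
        (auto simp: G_n)
    have "(\<Sum>i=1..<n. (norm (primal_residual n G x i))\<^sup>2)
        \<le> (\<Sum>i=1..<n. 2 * (norm (G i u - x i))\<^sup>2 + 2 * K\<^sup>2 * A)"
    proof (rule sum_mono)
      fix i assume "i \<in> {1..<n}"
      then have i: "i \<in> {1..n}"
        by simp
      have "primal_residual n G x i = G i (u - x n) - (G i u - x i)"
        using i u x by (simp add: primal_residual_def G_diff)
      then have "norm (primal_residual n G x i) \<le> norm (G i (u - x n)) + norm (G i u - x i)"
        by (simp add: norm_triangle_ineq4)
      then have "(norm (primal_residual n G x i))\<^sup>2 \<le> (norm (G i (u - x n)) + norm (G i u - x i))\<^sup>2"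
        by (simp add: power_mono)
      also have "\<dots> \<le> 2 * (norm (G i (u - x n)))\<^sup>2 + 2 * (norm (G i u - x i))\<^sup>2"
        using zero_le_power2[of "norm (G i (u - x n)) - norm (G i u - x i)"]
        by (simp add: power2_sum power2_diff)
      also have "(norm (G i (u - x n)))\<^sup>2 \<le> K\<^sup>2 * A"
      proof -
        have "(norm (G i (u - x n)))\<^sup>2 \<le> (K * norm (u - x n))\<^sup>2"
          using K[OF i subspace_diff[OF H0_subspace u x]] by (intro power_mono) auto
        also have "\<dots> \<le> K\<^sup>2 * A"
          using A_n by (simp add: power_mult_distrib mult_left_mono)
        finally show ?thesis .
      qed
      finally show "(norm (primal_residual n G x i))\<^sup>2 \<le> 2 * (norm (G i u - x i))\<^sup>2 + 2 * K\<^sup>2 * A"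
        by simp
    qed
    also have "\<dots> = 2 * (\<Sum>i=1..<n. (norm (G i u - x i))\<^sup>2) + real (n - 1) * (2 * K\<^sup>2 * A)"
      by (simp add: sum.distrib sum_distrib_left)
    also have "\<dots> \<le> 2 * A + real n * (2 * K\<^sup>2 * A)"
      using A0 by (intro add_mono mult_left_mono mult_right_mono) (auto simp: A_def intro!: sum_mono2)
    finally have primal: "(\<Sum>i=1..<n. (norm (primal_residual n G x i))\<^sup>2) \<le> (2 + 2 * K\<^sup>2 * n) * A"
      by (simp add: algebra_simps)
    have "inverse \<gamma> * (K\<^sup>2 * n) * B + (2 + 2 * K\<^sup>2 * n) * A \<le> C * B + C * A"
      using \<gamma> A0 B0 by (intro add_mono mult_right_mono) (auto simp: C_def)
    with dual primal show ?thesis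
      unfolding sum.distrib A_def[symmetric] B_def[symmetric] by (simp add: algebra_simps)
  qed
  ultimately show thesis
    using that by blast
qed

text \<open>The sum of the products of \<open>x\<close> and \<open>y\<close> tends to 0 by the
  residual identity, which is also its value at the limit point by orthogonality. The summed
  monotonicity inequality against any points of the graphs therefore survives the limit. Boundedness
  is assumed explicitly, since weak convergence along a filter does not make the whole range
  bounded.\<close>

lemma weak_limit_is_solution:
  fixes x y :: "nat \<Rightarrow> nat \<Rightarrow> 'a"
  assumes F: "F \<noteq> bot"
    and xy: "\<And>k i. i \<in> {1..n} \<Longrightarrow> x k i \<in> H i \<and> y k i \<in> T i (x k i)"
    and u: "u \<in> H 0" and v: "\<And>i. i \<in> {1..<n} \<Longrightarrow> v i \<in> H i"
    and x_lim: "weakly_tends_to {1..n} H x (\<lambda>i. G i u) F"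
    and y_lim: "weakly_tends_to {1..n} H y (ext v) F"
    and x_bounded: "bounded (range (\<lambda>k. x k n))"
    and y_bounded: "\<And>i. i \<in> {1..n} \<Longrightarrow> bounded (range (\<lambda>k. y k i))"
    and dual: "((\<lambda>k. dual_residual n H G (y k)) \<longlongrightarrow> 0) F"
    and primal: "\<And>i. i \<in> {1..<n} \<Longrightarrow> ((\<lambda>k. primal_residual n G (x k) i) \<longlongrightarrow> 0) F"
  shows "(u, v) \<in> extended_solution_set n H T G"
proof -
  have y_mem: "y k i \<in> H i" if "i \<in> {1..n}" for k i
    using xy[OF that] T[OF that] by (auto simp: maximal_monotone_def monotone_operator_def)
  have x_n: "x k n \<in> H 0" for k
    using xy[of n k] n H_n by simp
  have "((\<lambda>k. \<Sum>i=1..n. inner (x k i) (y k i)) \<longlongrightarrow> 0 + (\<Sum>i=1..<n. 0)) F"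
  proof (subst sum_inner_residual, rule x_n, intro tendsto_add tendsto_sum)
    show "((\<lambda>k. inner (x k n) (dual_residual n H G (y k))) \<longlongrightarrow> 0) F"
      using x_bounded dual by (rule tendsto_inner_bounded_null)
    show "((\<lambda>k. inner (primal_residual n G (x k) i) (y k i)) \<longlongrightarrow> 0) F" if "i \<in> {1..<n}" for i
      using tendsto_inner_bounded_null[OF y_bounded primal[OF that]] that by (simp add: inner_commute)
  qed
  then have xy_lim: "((\<lambda>k. \<Sum>i=1..n. inner (x k i) (y k i)) \<longlongrightarrow> 0) F"
    by simp
  have "ext v j \<in> T j (G j u)" if "j \<in> {1..n}" for j
  proof (rule maximal_monotone_product[OF _ T, where I = "{1..n}" and a = "\<lambda>i. G i u" and b = "ext v"])
    show "G i u \<in> H i \<and> ext v i \<in> H i" if "i \<in> {1..n}" for i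
      using that u v by (auto intro: G_mem ext_mem)
  next
    fix a b assume ab: "\<And>i. i \<in> {1..n} \<Longrightarrow> a i \<in> H i \<and> b i \<in> T i (a i)"
    have b_mem: "b i \<in> H i" if "i \<in> {1..n}" for i
      using ab[OF that] T[OF that] by (auto simp: maximal_monotone_def monotone_operator_def)
    have "((\<lambda>k. (\<Sum>i=1..n. inner (x k i) (y k i)) - (\<Sum>i=1..n. inner (x k i) (b i))
        - (\<Sum>i=1..n. inner (y k i) (a i)) + (\<Sum>i=1..n. inner (a i) (b i)))
      \<longlongrightarrow> 0 - (\<Sum>i=1..n. inner (G i u) (b i)) - (\<Sum>i=1..n. inner (ext v i) (a i))
        + (\<Sum>i=1..n. inner (a i) (b i))) F"
      using x_lim y_lim ab b_mem
      by (intro tendsto_add tendsto_diff tendsto_sum tendsto_const xy_lim)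
        (auto simp: weakly_tends_to_def)
    also have "(\<lambda>k. (\<Sum>i=1..n. inner (x k i) (y k i)) - (\<Sum>i=1..n. inner (x k i) (b i))
        - (\<Sum>i=1..n. inner (y k i) (a i)) + (\<Sum>i=1..n. inner (a i) (b i)))
      = (\<lambda>k. \<Sum>i=1..n. inner (x k i - a i) (y k i - b i))"
      by (simp add: inner_diff_left inner_diff_right sum_subtractf sum.distrib inner_commute
          algebra_simps)
    \<comment> \<open>The leading \<open>0\<close> is read as the sum of the products of
      \<open>G i u\<close> and \<open>ext v i\<close>.\<close>
    also have "0 - (\<Sum>i=1..n. inner (G i u) (b i)) - (\<Sum>i=1..n. inner (ext v i) (a i))
        + (\<Sum>i=1..n. inner (a i) (b i)) = (\<Sum>i=1..n. inner (G i u - a i) (ext v i - b i))"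
      using ext_orthogonal[OF u, of v]
      by (simp add: inner_diff_left inner_diff_right sum_subtractf sum.distrib inner_commute)
    finally have lim: "((\<lambda>k. \<Sum>i=1..n. inner (x k i - a i) (y k i - b i))
        \<longlongrightarrow> (\<Sum>i=1..n. inner (G i u - a i) (ext v i - b i))) F" .
    have "0 \<le> inner (x k i - a i) (y k i - b i)" if "i \<in> {1..n}" for k i
      using T[OF that] xy[OF that] ab[OF that]
      by (auto simp: maximal_monotone_def monotone_operator_def)
    then show "0 \<le> (\<Sum>i=1..n. inner (G i u - a i) (ext v i - b i))"
      by (intro tendsto_lowerbound[OF lim _ F] always_eventually allI sum_nonneg)
  qed (use that in auto)
  then show ?thesis
    using u v by (simp add: solution_iff)
qed

end

section \<open>The inertial splitting algorithm\<close>

lemma tendsto_zero_if_norm_square_le: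
  fixes f :: "'k \<Rightarrow> 'a::real_normed_vector"
  assumes "\<And>k. c * (norm (f k))\<^sup>2 \<le> g k" "0 < c" and g: "(g \<longlongrightarrow> 0) F"
  shows "(f \<longlongrightarrow> 0) F"
proof (rule tendsto_norm_zero_cancel, rule Lim_null_comparison)
  show "\<forall>\<^sub>F k in F. norm (norm (f k)) \<le> sqrt (g k / c)"
    using assms(1,2) by (intro always_eventually allI) (simp add: real_le_rsqrt field_simps)
  have "((\<lambda>k. sqrt (g k / c)) \<longlongrightarrow> sqrt 0) F"
    using g by (intro tendsto_real_sqrt tendsto_divide_zero)
  then show "((\<lambda>k. sqrt (g k / c)) \<longlongrightarrow> 0) F"
    by simp
qed

section \<open>An infinite run and its vectors in the product space\<close>

locale inertial_splitting = splitting_problem n H T G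
  for n :: nat
    and H :: "nat \<Rightarrow> 'a::real_inner set"
    and T :: "nat \<Rightarrow> 'a \<Rightarrow> 'a set"
    and G :: "nat \<Rightarrow> 'a \<Rightarrow> 'a" +
  fixes \<alpha> \<sigma> \<beta>_lo \<beta>_hi \<gamma> \<alpha>_bar \<rho>_lo \<rho>_hi :: real
    and z :: "nat \<Rightarrow> 'a"
    and w x y e :: "nat \<Rightarrow> nat \<Rightarrow> 'a"
    and \<rho> :: "nat \<Rightarrow> nat \<Rightarrow> real"
    and \<alpha>s \<beta>s :: "nat \<Rightarrow> real"
  assumes solvable: "\<exists>u\<in>H 0. 0 \<in> (\<Sum>i=1..n. adjoint_on (H 0) (G i) ` T i (G i u))"
    and run: "inertial_splitting_run n H T G \<alpha> \<sigma> \<beta>_lo \<beta>_hi \<gamma> z w x y e \<rho> \<alpha>s \<beta>s"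
    and \<alpha>_bar: "0 < \<alpha>_bar" "\<alpha> < \<alpha>_bar" "\<alpha>_bar < 1"
    and \<alpha>s: "\<And>k. 0 \<le> \<alpha>s k \<and> \<alpha>s k \<le> \<alpha>s (Suc k) \<and> \<alpha>s (Suc k) \<le> \<alpha>"
    and \<beta>_hi: "\<beta>_hi = 2 * (\<alpha>_bar - 1)\<^sup>2 / (2 * (\<alpha>_bar - 1)\<^sup>2 + 3 * \<alpha>_bar - 1)"
    and \<rho>_lo: "0 < \<rho>_lo"
    and \<rho>: "\<And>i k. i \<in> {1..n} \<Longrightarrow> \<rho>_lo \<le> \<rho> k i \<and> \<rho> k i \<le> \<rho>_hi"
begin

definition zh :: "nat \<Rightarrow> 'a" where
  "zh k = z k + \<alpha>s k *\<^sub>R (z k - z (k - 1))"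

definition wh :: "nat \<Rightarrow> nat \<Rightarrow> 'a" where
  "wh k = ext (\<lambda>i. w k i + \<alpha>s k *\<^sub>R (w k i - w (k - 1) i))"

definition \<phi> :: "nat \<Rightarrow> real" where
  "\<phi> k = separator n H G (x k) (y k) (zh k) (wh k)"

definition \<theta> :: "nat \<Rightarrow> real" where
  "\<theta> k = step_length n H G \<gamma> (x k) (y k) (zh k) (wh k)"

definition gap :: "nat \<Rightarrow> real" where
  "gap k = (\<Sum>i=1..n. (norm (G i (zh k) - x k i))\<^sup>2 + (norm (y k i - wh k i))\<^sup>2)"

text \<open>
  The product space is represented by families indexed by \<open>{..<n}\<close>, with \<open>z\<close> as component \<open>0\<close>;
  the weight \<open>c\<close> encodes the norm depending on \<open>\<gamma>\<close>.
\<close>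

definition P :: "nat \<Rightarrow> nat \<Rightarrow> 'a" where
  "P k i = (if i = 0 then z k else w k i)"

definition Ph :: "nat \<Rightarrow> nat \<Rightarrow> 'a" where
  "Ph k i = (if i = 0 then zh k else wh k i)"

text \<open>The gradient of the separator for the weighted inner product, whence the factor
  \<open>inverse \<gamma>\<close>; all components of the update then have the same form.\<close>

definition grad :: "nat \<Rightarrow> nat \<Rightarrow> 'a" where
  "grad k i = (if i = 0 then inverse \<gamma> *\<^sub>R dual_residual n H G (y k) else primal_residual n G (x k) i)"

definition c :: "nat \<Rightarrow> real" where
  "c i = (if i = 0 then \<gamma> else 1)"

lemma parameters:
  "0 \<le> \<alpha>" "\<alpha> < 1" "0 \<le> \<sigma>" "\<sigma> < 1" "0 < \<beta>_lo" "\<beta>_lo \<le> \<beta>_hi" "\<beta>_hi < 2" "0 < \<gamma>"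
  using run unfolding inertial_splitting_run_def by blast+

lemma initial: "z 0 \<in> H 0" "\<And>i. i \<in> {1..<n} \<Longrightarrow> w 0 i \<in> H i"
proof -
  have "(z 0, w 0) \<in> product_space n H"
    using run unfolding inertial_splitting_run_def by blast
  then show "z 0 \<in> H 0" "\<And>i. i \<in> {1..<n} \<Longrightarrow> w 0 i \<in> H i"
    by (auto simp: product_space_def)
qed

lemma iteration:
  shows x_mem: "i \<in> {1..n} \<Longrightarrow> x k i \<in> H i"
    and y_T: "i \<in> {1..n} \<Longrightarrow> y k i \<in> T i (x k i)"
    and resolvent: "i \<in> {1..n} \<Longrightarrow>
      \<rho> k i *\<^sub>R y k i + x k i = G i (zh k) + \<rho> k i *\<^sub>R wh k i + e k i"
    and error: "i \<in> {1..n} \<Longrightarrow> (norm (e k i))\<^sup>2 \<le>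
      \<sigma>\<^sup>2 * ((norm (G i (zh k) - x k i))\<^sup>2 + (norm (\<rho> k i *\<^sub>R (wh k i - y k i)))\<^sup>2)"
    and no_stop: "\<not> ((\<forall>i\<in>{1..<n}. primal_residual n G (x k) i = 0) \<and> dual_residual n H G (y k) = 0)"
    and \<beta>s: "\<beta>_lo \<le> \<beta>s k" "\<beta>s k \<le> \<beta>_hi"
    and z_Suc: "z (Suc k) = zh k - (inverse \<gamma> * \<beta>s k * \<theta> k) *\<^sub>R dual_residual n H G (y k)"
    and w_Suc: "i \<in> {1..<n} \<Longrightarrow>
      w (Suc k) i = wh k i - (\<beta>s k * \<theta> k) *\<^sub>R primal_residual n G (x k) i"
proof -
  have step: "\<forall>k. \<alpha>s k \<in> {0..\<alpha>} \<and>
      (\<forall>i\<in>{1..n}. \<rho> k i > 0 \<and> x k i \<in> H i \<and> e k i \<in> H i \<and> y k i \<in> T i (x k i) \<and>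
         \<rho> k i *\<^sub>R y k i + x k i = G i (zh k) + \<rho> k i *\<^sub>R wh k i + e k i \<and>
         (norm (e k i))\<^sup>2 \<le>
           \<sigma>\<^sup>2 * ((norm (G i (zh k) - x k i))\<^sup>2 + (norm (\<rho> k i *\<^sub>R (wh k i - y k i)))\<^sup>2)) \<and>
      \<not> ((\<forall>i\<in>{1..<n}. x k i = G i (x k n)) \<and> (\<Sum>i=1..<n. adj i (y k i)) + y k n = 0) \<and>
      \<beta>s k \<in> {\<beta>_lo..\<beta>_hi} \<and>
      z (Suc k) = zh k - (inverse \<gamma> * \<beta>s k * \<theta> k) *\<^sub>R dual_residual n H G (y k) \<and>
      (\<forall>i\<in>{1..<n}. w (Suc k) i = wh k i - (\<beta>s k * \<theta> k) *\<^sub>R primal_residual n G (x k) i)"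
    unfolding zh_def wh_def \<theta>_def
    by (rule run[unfolded inertial_splitting_run_def Let_def, THEN conjunct2, THEN conjunct2,
          THEN conjunct2, THEN conjunct2, THEN conjunct2, THEN conjunct2, THEN conjunct2,
          THEN conjunct2, THEN conjunct2])
  show "i \<in> {1..n} \<Longrightarrow> x k i \<in> H i" "i \<in> {1..n} \<Longrightarrow> y k i \<in> T i (x k i)"
    "i \<in> {1..n} \<Longrightarrow> \<rho> k i *\<^sub>R y k i + x k i = G i (zh k) + \<rho> k i *\<^sub>R wh k i + e k i"
    "i \<in> {1..n} \<Longrightarrow> (norm (e k i))\<^sup>2 \<le>
      \<sigma>\<^sup>2 * ((norm (G i (zh k) - x k i))\<^sup>2 + (norm (\<rho> k i *\<^sub>R (wh k i - y k i)))\<^sup>2)"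
    "z (Suc k) = zh k - (inverse \<gamma> * \<beta>s k * \<theta> k) *\<^sub>R dual_residual n H G (y k)"
    "i \<in> {1..<n} \<Longrightarrow> w (Suc k) i = wh k i - (\<beta>s k * \<theta> k) *\<^sub>R primal_residual n G (x k) i"
    using step by blast+
  show "\<beta>_lo \<le> \<beta>s k" "\<beta>s k \<le> \<beta>_hi"
    using step by (metis atLeastAtMost_iff)+
  show "\<not> ((\<forall>i\<in>{1..<n}. primal_residual n G (x k) i = 0) \<and> dual_residual n H G (y k) = 0)"
    unfolding primal_residual_def dual_residual_def right_minus_eq using step by blast
qed

lemma y_mem: "i \<in> {1..n} \<Longrightarrow> y k i \<in> H i"
  using y_T[of i k] x_mem[of i k] T[of i] by (auto simp: maximal_monotone_def monotone_operator_def)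

lemma x_n_mem: "x k n \<in> H 0"
  using x_mem[of n k] n H_n by simp

lemma \<alpha>s_le: "\<alpha>s k \<le> \<alpha>"
  using \<alpha>s[of k] by linarith

lemma wh_less: "i \<in> {1..<n} \<Longrightarrow> wh k i = w k i + \<alpha>s k *\<^sub>R (w k i - w (k - 1) i)"
  by (simp add: wh_def ext_less)

text \<open>Extension reads only the indices in \<open>{1..<n}\<close>, so extending twice is
  harmless; the separator formulas extend their argument once more.\<close>

lemma ext_wh: "ext (wh k) = wh k"
  by (auto simp: wh_def dual_extend_def fun_eq_iff intro!: sum.cong)

lemma Ph_eq: "i \<in> {..<n} \<Longrightarrow> Ph k i = P k i + \<alpha>s k *\<^sub>R (P k i - P (k - 1) i)"
  by (simp add: Ph_def P_def zh_def wh_less)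

lemma P_Suc: "i \<in> {..<n} \<Longrightarrow> P (Suc k) i = Ph k i - (\<beta>s k * \<theta> k) *\<^sub>R grad k i"
  by (simp add: Ph_def P_def grad_def z_Suc w_Suc mult_ac)

lemma c_pos: "0 < c i"
  by (simp add: c_def parameters)

lemma sum_first: "(\<Sum>i<n. f i) = f 0 + (\<Sum>i=1..<n. f i :: real)"
proof -
  have "{..<n} = insert 0 {1..<n}"
    using n by auto
  then show ?thesis
    by simp
qed

lemma grad_mem:
  assumes "i \<in> {..<n}"
  shows "grad k i \<in> H i"
proof (cases "i = 0")
  case True
  have "y k n \<in> H 0"
    using y_mem[of n k] n H_n by simp
  then have "dual_residual n H G (y k) \<in> H 0"
    unfolding dual_residual_def
    by (intro subspace_add subspace_sum H0_subspace adj_mem) auto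
  then show ?thesis
    using True by (simp add: grad_def subspace_scale H0_subspace)
next
  case False
  then have "i \<in> {1..n}"
    using assms by simp
  then show ?thesis
    using False x_mem G_mem x_n_mem H_subspace[of i]
    by (simp add: grad_def primal_residual_def subspace_diff)
qed

lemma P_mem: "i \<in> {..<n} \<Longrightarrow> P k i \<in> H i"
proof (induction k rule: less_induct)
  case (less k)
  show ?case
  proof (cases k)
    case 0
    then show ?thesis
      using less.prems initial by (simp add: P_def)
  next
    case (Suc m)
    have "subspace (H i)"
      using less.prems by (simp add: H_subspace)
    \<comment> \<open>Extrapolation looks back two iterates, hence the strong induction; for
      \<open>m = 0\<close> both are the initial point.\<close>
    moreover have "P m i \<in> H i" "P (m - 1) i \<in> H i"
      using less Suc by auto
    ultimately show ?thesis
      unfolding Suc using less.prems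
      by (simp add: P_Suc Ph_eq subspace_add subspace_diff subspace_scale grad_mem)
  qed
qed

lemma Ph_mem:
  assumes "i \<in> {..<n}"
  shows "Ph k i \<in> H i"
proof -
  have "subspace (H i)"
    using assms by (simp add: H_subspace)
  then show ?thesis
    using assms P_mem by (simp add: Ph_eq subspace_add subspace_diff subspace_scale)
qed

lemma zh_mem: "zh k \<in> H 0"
  using Ph_mem[of 0 k] n by (simp add: Ph_def)

section \<open>Step length and error criterion\<close>

lemma sqnorm_grad:
  "sqnorm {..<n} c (grad k) = inverse \<gamma> * (norm (dual_residual n H G (y k)))\<^sup>2
     + (\<Sum>i=1..<n. (norm (primal_residual n G (x k) i))\<^sup>2)"
proof -
  have "\<gamma> * (inverse \<gamma> * inverse \<gamma>) = inverse \<gamma>"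
    using parameters by simp
  then have "\<gamma> * (norm (inverse \<gamma> *\<^sub>R dual_residual n H G (y k)))\<^sup>2
      = inverse \<gamma> * (norm (dual_residual n H G (y k)))\<^sup>2"
    using parameters by (simp add: power_mult_distrib power2_eq_square mult_ac)
  then show ?thesis
    unfolding sqnorm_def sum_first by (simp add: grad_def c_def)
qed

text \<open>A vanishing gradient is exactly the stopping criterion, so the quotient defining the
  step length is genuine.\<close>

lemma sqnorm_grad_pos: "0 < sqnorm {..<n} c (grad k)"
proof -
  have nonneg: "0 \<le> inverse \<gamma> * (norm (dual_residual n H G (y k)))\<^sup>2"
    "0 \<le> (\<Sum>i=1..<n. (norm (primal_residual n G (x k) i))\<^sup>2)"
    using parameters by (auto intro: sum_nonneg)
  have "sqnorm {..<n} c (grad k) \<noteq> 0"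
  proof
    assume "sqnorm {..<n} c (grad k) = 0"
    then have "inverse \<gamma> * (norm (dual_residual n H G (y k)))\<^sup>2 = 0"
      "(\<Sum>i=1..<n. (norm (primal_residual n G (x k) i))\<^sup>2) = 0"
      using nonneg unfolding sqnorm_grad by linarith+
    then show False
      using no_stop[of k] parameters by (simp add: sum_nonneg_eq_0_iff)
  qed
  moreover have "0 \<le> sqnorm {..<n} c (grad k)"
    using nonneg unfolding sqnorm_grad by linarith
  ultimately show ?thesis
    by simp
qed

lemma \<theta>_mult: "\<theta> k * sqnorm {..<n} c (grad k) = max 0 (\<phi> k)"
  using sqnorm_grad_pos[of k] unfolding \<theta>_def step_length_def sqnorm_grad[symmetric] \<phi>_def
  by simp

text \<open>
  With \<open>a = G i zh - x i\<close> and \<open>b = \<rho> i (y i - wh i) = a + e i\<close>, the error criterion reads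
  \<open>\<parallel>b - a\<parallel>\<^sup>2 \<le> \<sigma>\<^sup>2 (\<parallel>a\<parallel>\<^sup>2 + \<parallel>b\<parallel>\<^sup>2)\<close> and so bounds \<open>\<langle>a, b\<rangle>\<close> from below.
\<close>

lemma \<phi>_ge_gap:
  obtains \<kappa> where "0 < \<kappa>" "\<And>k. \<kappa> * gap k \<le> \<phi> k"
proof -
  \<comment> \<open>Expanding the square in the error criterion leaves the factor
    \<open>1 - \<sigma>\<^sup>2\<close> against twice the inner product.\<close>
  define s where "s = (1 - \<sigma>\<^sup>2) / 2"
  have "\<sigma>\<^sup>2 < 1"
    using parameters by (simp add: abs_square_less_1)
  then have s: "0 < s"
    by (simp add: s_def)
  \<comment> \<open>After division by \<open>r = \<rho> k i\<close> the two squares carry the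
    coefficients \<open>s / r\<close> and \<open>s * r\<close>; \<kappa> is below both for every
    admissible \<open>r\<close>.\<close>
  define \<kappa> where "\<kappa> = s * min (1 / \<rho>_hi) \<rho>_lo"
  have \<rho>_hi: "0 < \<rho>_hi"
    using \<rho>[of n 0] \<rho>_lo n by simp
  have "\<kappa> * gap k \<le> \<phi> k" for k
  proof -
    have "\<kappa> * ((norm (G i (zh k) - x k i))\<^sup>2 + (norm (y k i - wh k i))\<^sup>2)
        \<le> inner (G i (zh k) - x k i) (y k i - wh k i)" if i: "i \<in> {1..n}" for i
    proof -
      define a where "a = G i (zh k) - x k i"
      define d where "d = y k i - wh k i"
      define r where "r = \<rho> k i"
      have r: "\<rho>_lo \<le> r" "r \<le> \<rho>_hi" "0 < r"
        using \<rho>[OF i, of k] \<rho>_lo by (auto simp: r_def)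
      have e: "e k i = r *\<^sub>R d - a"
        using resolvent[OF i, of k] by (simp add: a_def d_def r_def algebra_simps)
      have "norm (wh k i - y k i) = norm d"
        by (simp add: d_def norm_minus_commute)
      then have "(norm (r *\<^sub>R d - a))\<^sup>2 \<le> \<sigma>\<^sup>2 * ((norm a)\<^sup>2 + (norm (r *\<^sub>R d))\<^sup>2)"
        using error[OF i, of k] e by (simp add: a_def r_def)
      moreover have "(norm (r *\<^sub>R d - a))\<^sup>2 = (norm a)\<^sup>2 + (norm (r *\<^sub>R d))\<^sup>2 - 2 * r * inner a d"
        unfolding power2_norm_eq_inner by (simp add: inner_diff_left inner_diff_right inner_commute)
      moreover have "(norm (r *\<^sub>R d))\<^sup>2 = r\<^sup>2 * (norm d)\<^sup>2"
        by (simp add: power_mult_distrib)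
      ultimately have "s * ((norm a)\<^sup>2 + r\<^sup>2 * (norm d)\<^sup>2) \<le> r * inner a d"
        by (simp add: s_def field_simps)
      then have "s * ((norm a)\<^sup>2 + r\<^sup>2 * (norm d)\<^sup>2) / r \<le> inner a d"
        using r by (simp add: field_simps)
      moreover have "s * ((norm a)\<^sup>2 + r\<^sup>2 * (norm d)\<^sup>2) / r = s * (1 / r) * (norm a)\<^sup>2 + s * r * (norm d)\<^sup>2"
        using r by (simp add: power2_eq_square field_simps)
      moreover have "1 / \<rho>_hi \<le> 1 / r"
        using r by (intro divide_left_mono) auto
      then have "\<kappa> * (norm a)\<^sup>2 \<le> s * (1 / r) * (norm a)\<^sup>2" "\<kappa> * (norm d)\<^sup>2 \<le> s * r * (norm d)\<^sup>2"
        unfolding \<kappa>_def using s r by (intro mult_right_mono mult_left_mono; simp)+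
      ultimately show ?thesis
        unfolding a_def[symmetric] d_def[symmetric] by (simp add: distrib_left)
    qed
    then have "\<kappa> * gap k \<le> (\<Sum>i=1..n. inner (G i (zh k) - x k i) (y k i - wh k i))"
      unfolding gap_def sum_distrib_left by (rule sum_mono)
    then show ?thesis
      by (simp add: \<phi>_def separator_eq_sum[OF zh_mem] ext_wh)
  qed
  moreover have "0 < \<kappa>"
    using s \<rho>_lo \<rho>_hi by (simp add: \<kappa>_def)
  ultimately show thesis
    using that by blast
qed

lemma gap_nonneg: "0 \<le> gap k"
  by (auto simp: gap_def intro: sum_nonneg)

lemma \<phi>_nonneg: "0 \<le> \<phi> k"
proof -
  obtain \<kappa> where "0 < \<kappa>" "\<kappa> * gap k \<le> \<phi> k"
    using \<phi>_ge_gap by blast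
  then show ?thesis
    using mult_nonneg_nonneg[OF less_imp_le gap_nonneg[of k], of \<kappa>] by linarith
qed

text \<open>A step with relaxation \<open>b\<close> lowers the squared distance by at least
  \<open>b * (2 - b) * \<theta> k * \<phi> k\<close>, that is, by \<open>2 / b - 1\<close> times its
  squared length; \<eta> is the worst such factor for \<open>b\<close> up to
  \<open>\<beta>_hi\<close>.\<close>

definition \<eta> :: real where
  "\<eta> = 2 / \<beta>_hi - 1"

lemma \<eta>_pos: "0 < \<eta>"
  using parameters by (simp add: \<eta>_def field_simps)

text \<open>The formula for \<open>\<beta>_hi\<close> says precisely that equality holds at
  \<open>\<alpha>_bar\<close>. Passing from \<open>\<alpha>_bar\<close> down to \<alpha> strictly
  decreases the left side and does not decrease the right side.\<close>

lemma \<eta>_gap: "\<alpha> * (1 + \<alpha>) < \<eta> * (1 - \<alpha>)\<^sup>2"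
proof -
  define m where "m = (\<alpha>_bar - 1)\<^sup>2"
  have m: "0 < m"
    using \<alpha>_bar by (simp add: m_def)
  have "2 / \<beta>_hi = (2 * m + 3 * \<alpha>_bar - 1) / m"
    using m by (simp add: \<beta>_hi m_def[symmetric] field_simps)
  then have "\<eta> * m = m + 3 * \<alpha>_bar - 1"
    using m by (simp add: \<eta>_def field_simps)
  also have "\<dots> = \<alpha>_bar * (1 + \<alpha>_bar)"
    by (simp add: m_def power2_eq_square algebra_simps)
  finally have eq: "\<eta> * (1 - \<alpha>_bar)\<^sup>2 = \<alpha>_bar * (1 + \<alpha>_bar)"
    by (simp add: m_def power2_commute)
  have "\<alpha> * (1 + \<alpha>) < \<alpha>_bar * (1 + \<alpha>_bar)"
    using \<alpha>_bar parameters by (intro mult_strict_mono) auto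
  also have "\<dots> = \<eta> * (1 - \<alpha>_bar)\<^sup>2"
    by (simp add: eq)
  also have "\<dots> \<le> \<eta> * (1 - \<alpha>)\<^sup>2"
    using \<alpha>_bar \<eta>_pos by (intro mult_left_mono power_mono) auto
  finally show ?thesis .
qed

text \<open>One family plays both roles: \<open>q 0\<close> is the primal part, and as a dual part
  \<open>q\<close> is read only at the indices in \<open>{1..<n}\<close>.\<close>

definition S :: "(nat \<Rightarrow> 'a) set" where
  "S = {q. (q 0, q) \<in> extended_solution_set n H T G}"

lemma sqnorm_step:
  "sqnorm {..<n} c (\<lambda>i. P (Suc k) i - Ph k i) = (\<beta>s k)\<^sup>2 * (\<theta> k * \<phi> k)"
proof -
  have "sqnorm {..<n} c (\<lambda>i. P (Suc k) i - Ph k i) = (\<beta>s k * \<theta> k)\<^sup>2 * sqnorm {..<n} c (grad k)"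
    unfolding sqnorm_def sum_distrib_left
    by (intro sum.cong refl) (simp add: P_Suc power_mult_distrib)
  also have "\<dots> = (\<beta>s k)\<^sup>2 * (\<theta> k * (\<theta> k * sqnorm {..<n} c (grad k)))"
    by (simp add: power2_eq_square mult_ac)
  finally show ?thesis
    using \<phi>_nonneg[of k] by (simp add: \<theta>_mult)
qed

lemma fejer:
  assumes q: "q \<in> S"
  shows "sqnorm {..<n} c (\<lambda>i. P (Suc k) i - q i) + \<eta> * sqnorm {..<n} c (\<lambda>i. P (Suc k) i - Ph k i)
           \<le> sqnorm {..<n} c (\<lambda>i. Ph k i - q i)"
proof -
  have sol: "(q 0, q) \<in> extended_solution_set n H T G" and q0: "q 0 \<in> H 0"
    using q by (auto simp: S_def solution_iff)
  define t where "t = \<beta>s k * \<theta> k"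
  define I where "I = (\<Sum>i<n. c i * inner (grad k i) (Ph k i - q i))"
  have "sqnorm {..<n} c (\<lambda>i. P (Suc k) i - q i) = sqnorm {..<n} c (\<lambda>i. (Ph k i - q i) - t *\<^sub>R grad k i)"
    unfolding sqnorm_def t_def by (intro sum.cong refl) (simp add: P_Suc algebra_simps)
  also have "\<dots> = sqnorm {..<n} c (\<lambda>i. Ph k i - q i) - 2 * t * I + t\<^sup>2 * sqnorm {..<n} c (grad k)"
    by (simp add: sqnorm_diff_scaled I_def)
  also have "t\<^sup>2 * sqnorm {..<n} c (grad k) = (\<beta>s k)\<^sup>2 * (\<theta> k * (\<theta> k * sqnorm {..<n} c (grad k)))"
    by (simp add: t_def power2_eq_square mult_ac)
  also have "\<dots> = (\<beta>s k)\<^sup>2 * (\<theta> k * \<phi> k)"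
    using \<phi>_nonneg[of k] by (simp add: \<theta>_mult)
  finally have eq: "sqnorm {..<n} c (\<lambda>i. P (Suc k) i - q i) =
      sqnorm {..<n} c (\<lambda>i. Ph k i - q i) - 2 * t * I + (\<beta>s k)\<^sup>2 * (\<theta> k * \<phi> k)" .
  have "I = inner (zh k - q 0) (dual_residual n H G (y k))
      + (\<Sum>i=1..<n. inner (primal_residual n G (x k) i) (wh k i - q i))"
    unfolding I_def sum_first using parameters
    by (simp add: c_def grad_def Ph_def inner_commute)
  \<comment> \<open>An affine function changes by the inner product of its gradient with the
    displacement; the value at the solution is nonpositive.\<close>
  also have "\<dots> = \<phi> k - separator n H G (x k) (y k) (q 0) q"
    using q0 zh_mem x_n_mem
    by (simp add: \<phi>_def separator_affine inner_diff_left inner_diff_right sum_subtractf)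
  also have "\<dots> \<ge> \<phi> k"
    using separator_nonpos[OF sol, of "x k" "y k"] x_mem y_T by simp
  finally have I: "\<phi> k \<le> I" .
  have \<theta>: "0 \<le> \<theta> k"
    using \<theta>_mult[of k] sqnorm_grad_pos[of k] by (metis max.cobounded1 zero_le_mult_iff not_less)
  have \<beta>: "0 < \<beta>s k" "\<beta>s k \<le> \<beta>_hi"
    using \<beta>s[of k] parameters by auto
  have "2 * t * \<phi> k \<le> 2 * t * I"
    using I \<beta> \<theta> by (intro mult_left_mono) (auto simp: t_def)
  \<comment> \<open>By definition \<open>1 + \<eta>\<close> equals
    \<open>2 / \<beta>_hi\<close>.\<close>
  moreover have "(1 + \<eta>) * \<beta>s k \<le> 2"
    using \<beta> parameters by (simp add: \<eta>_def field_simps)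
  then have "(1 + \<eta>) * \<beta>s k * (\<beta>s k * (\<theta> k * \<phi> k)) \<le> 2 * (\<beta>s k * (\<theta> k * \<phi> k))"
    using \<beta> \<theta> \<phi>_nonneg[of k] by (intro mult_right_mono) auto
  then have "(1 + \<eta>) * ((\<beta>s k)\<^sup>2 * (\<theta> k * \<phi> k)) \<le> 2 * t * \<phi> k"
    by (simp add: t_def power2_eq_square mult_ac)
  ultimately show ?thesis
    unfolding eq sqnorm_step by (simp add: distrib_right)
qed

lemma S_nonempty: "S \<noteq> {}"
proof -
  obtain u where u: "u \<in> H 0" and "0 \<in> (\<Sum>i=1..n. adj i ` T i (G i u))"
    using solvable by blast
  then obtain s where s: "0 = (\<Sum>i=1..n. s i)" "\<And>i. i \<in> {1..n} \<Longrightarrow> s i \<in> adj i ` T i (G i u)"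
    by (auto simp: set_sum_alt)
  then obtain v where v: "\<And>i. i \<in> {1..n} \<Longrightarrow> v i \<in> T i (G i u)" "\<And>i. i \<in> {1..n} \<Longrightarrow> s i = adj i (v i)"
    unfolding image_iff by metis
  have v_mem: "v i \<in> H i" if "i \<in> {1..n}" for i
    using v(1)[OF that] T[OF that] G_mem[OF that u]
    by (auto simp: maximal_monotone_def monotone_operator_def)
  define q where "q = (\<lambda>i. if i = 0 then u else v i)"
  have "v n \<in> H 0"
    using v_mem[of n] n H_n by simp
  moreover have "(\<Sum>i=1..n. s i) = (\<Sum>i=1..n. adj i (v i))"
    using v(2) by (rule sum.cong[OF refl])
  \<comment> \<open>Since \<open>adj n\<close> is the identity on \<open>H 0\<close>, the inclusion
    says that the chosen \<open>v n\<close> is the forced last component of the extension.\<close>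
  ultimately have "(\<Sum>i=1..<n. adj i (v i)) + v n = 0"
    using s(1) unfolding sum_last by (simp add: adj_n)
  moreover have "(\<Sum>i=1..<n. adj i (q i)) = (\<Sum>i=1..<n. adj i (v i))"
    by (intro sum.cong) (auto simp: q_def)
  ultimately have "ext q n = v n"
    unfolding ext_last by (simp add: eq_neg_iff_add_eq_0 minus_equation_iff add.commute neg_eq_iff_add_eq_0)
  then have "ext q i \<in> T i (G i u)" if "i \<in> {1..n}" for i
    using that v(1)[OF that] by (cases "i = n") (auto simp: ext_less q_def)
  then have "q \<in> S"
    using u v_mem by (auto simp: S_def solution_iff q_def)
  then show ?thesis
    by blast
qed

section \<open>Vanishing of steps, residuals and gaps\<close>

lemma inertial_conclusions:
  assumes "q \<in> S"
  shows "convergent (\<lambda>k. sqnorm {..<n} c (\<lambda>i. P k i - q i))"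
    and "(\<lambda>k. sqnorm {..<n} c (\<lambda>i. P k i - P (k - 1) i)) \<longlonglongrightarrow> 0"
    and "(\<lambda>k. sqnorm {..<n} c (\<lambda>i. P (Suc k) i - Ph k i)) \<longlonglongrightarrow> 0"
proof -
  have a: "0 \<le> \<alpha>s k" "\<alpha>s k \<le> \<alpha>s (Suc k)" for k
    using \<alpha>s[of k] by auto
  note conv = inertial_fejer[where I = "{..<n}" and c = c and a = \<alpha>s and \<alpha> = \<alpha> and \<eta> = \<eta>
      and P = P and Ph = Ph and q = q,
      OF less_imp_le[OF c_pos] a \<alpha>s_le parameters(2) less_imp_le[OF \<eta>_pos] \<eta>_gap Ph_eq fejer[OF assms]]
  show "convergent (\<lambda>k. sqnorm {..<n} c (\<lambda>i. P k i - q i))"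
    by (rule conv(1))
  show "(\<lambda>k. sqnorm {..<n} c (\<lambda>i. P k i - P (k - 1) i)) \<longlonglongrightarrow> 0"
    by (rule conv(2))
  show "(\<lambda>k. sqnorm {..<n} c (\<lambda>i. P (Suc k) i - Ph k i)) \<longlonglongrightarrow> 0"
    by (rule conv(3))
qed

lemma sqnorm_grad_le_gap:
  obtains C where "0 < C" "\<And>k. sqnorm {..<n} c (grad k) \<le> C * gap k"
proof (rule residual_bound[OF parameters(8)])
  fix C :: real
  assume "0 < C" and C: "\<And>x y u w. u \<in> H 0 \<Longrightarrow> x n \<in> H 0 \<Longrightarrow>
       inverse \<gamma> * (norm (dual_residual n H G y))\<^sup>2 + (\<Sum>i=1..<n. (norm (primal_residual n G x i))\<^sup>2)
       \<le> C * (\<Sum>i=1..n. (norm (G i u - x i))\<^sup>2 + (norm (y i - ext w i))\<^sup>2)"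
  have "sqnorm {..<n} c (grad k) \<le> C * gap k" for k
    using C[where u = "zh k" and x = "x k" and y = "y k" and w = "wh k", OF zh_mem x_n_mem]
    by (simp only: sqnorm_grad gap_def ext_wh)
  with \<open>0 < C\<close> show thesis
    by (rule that)
qed

text \<open>The separator value is at least \<open>\<kappa> * gap k\<close>, the squared gradient at
  most \<open>C * gap k\<close>. Their ratio
  \<open>\<theta> k * \<phi> k = (\<phi> k)\<^sup>2 / D\<close> therefore dominates a multiple of
  \<open>gap k\<close>, and up to \<open>(\<beta>s k)\<^sup>2\<close> it is the squared step, which
  tends to zero.\<close>

lemma gap_tendsto_0: "gap \<longlonglongrightarrow> 0"
proof -
  obtain \<kappa> where \<kappa>: "0 < \<kappa>" "\<And>k. \<kappa> * gap k \<le> \<phi> k"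
    using \<phi>_ge_gap by blast
  obtain C where C: "0 < C" "\<And>k. sqnorm {..<n} c (grad k) \<le> C * gap k"
    using sqnorm_grad_le_gap by blast
  obtain q where "q \<in> S"
    using S_nonempty by blast
  note lim = inertial_conclusions(3)[OF this]
  define K where "K = C / (\<beta>_lo\<^sup>2 * \<kappa>\<^sup>2)"
  have "gap k \<le> K * sqnorm {..<n} c (\<lambda>i. P (Suc k) i - Ph k i)" for k
  proof -
    define D where "D = sqnorm {..<n} c (grad k)"
    have D: "0 < D" "D \<le> C * gap k"
      using sqnorm_grad_pos C by (auto simp: D_def)
    \<comment> \<open>A nonzero gradient excludes a zero gap, which permits cancelling one factor
      \<open>gap k\<close> below.\<close>
    then have gap: "0 < gap k"
      using C(1) by (metis less_le_trans zero_less_mult_pos)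
    have \<theta>: "\<theta> k * D = \<phi> k"
      using \<phi>_nonneg[of k] by (simp add: \<theta>_mult D_def)
    have "\<kappa>\<^sup>2 * (gap k)\<^sup>2 \<le> (\<phi> k)\<^sup>2"
      unfolding power_mult_distrib[symmetric] using \<kappa> gap by (intro power_mono) auto
    also have "\<dots> = \<theta> k * \<phi> k * D"
      using \<theta> by (simp add: power2_eq_square mult_ac)
    also have "\<dots> \<le> \<theta> k * \<phi> k * (C * gap k)"
    proof (intro mult_left_mono D(2))
      have "\<theta> k = \<phi> k / D"
        using \<theta> D(1) by (simp add: field_simps)
      then show "0 \<le> \<theta> k * \<phi> k"
        using \<phi>_nonneg[of k] D(1) by simp
    qed
    finally have *: "\<kappa>\<^sup>2 * gap k \<le> \<theta> k * \<phi> k * C"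
      using gap by (simp add: power2_eq_square mult_ac)
    have "\<beta>_lo\<^sup>2 * \<kappa>\<^sup>2 * gap k \<le> (\<beta>s k)\<^sup>2 * (\<theta> k * \<phi> k * C)"
      unfolding mult.assoc[of "\<beta>_lo\<^sup>2"]
    proof (rule mult_mono)
      show "\<beta>_lo\<^sup>2 \<le> (\<beta>s k)\<^sup>2"
        using \<beta>s[of k] parameters(5) by (intro power_mono) auto
    qed (use * gap in auto)
    then show ?thesis
      using parameters(5) \<kappa>(1) unfolding sqnorm_step by (simp add: K_def field_simps)
  qed
  then have bound: "\<forall>k. norm (gap k) \<le> K * sqnorm {..<n} c (\<lambda>i. P (Suc k) i - Ph k i)"
    using gap_nonneg by simp
  show ?thesis
    by (rule Lim_null_comparison[OF always_eventually[OF bound]]) (intro tendsto_mult_right_zero lim)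
qed

lemma gap_component:
  assumes i: "i \<in> {1..n}"
  shows "(norm (G i (zh k) - x k i))\<^sup>2 \<le> gap k" "(norm (y k i - wh k i))\<^sup>2 \<le> gap k"
proof -
  have "(norm (G i (zh k) - x k i))\<^sup>2 + (norm (y k i - wh k i))\<^sup>2 \<le> gap k"
    unfolding gap_def using i
    by (intro member_le_sum[where f = "\<lambda>i. (norm (G i (zh k) - x k i))\<^sup>2 + (norm (y k i - wh k i))\<^sup>2"]) auto
  then show "(norm (G i (zh k) - x k i))\<^sup>2 \<le> gap k" "(norm (y k i - wh k i))\<^sup>2 \<le> gap k"
    using zero_le_power2[of "norm (G i (zh k) - x k i)"] zero_le_power2[of "norm (y k i - wh k i)"]
    by linarith+
qed

lemma
  assumes i: "i \<in> {1..n}"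
  shows G_zh_minus_x: "(\<lambda>k. G i (zh k) - x k i) \<longlonglongrightarrow> 0"
    and y_minus_wh: "(\<lambda>k. y k i - wh k i) \<longlonglongrightarrow> 0"
proof -
  have bounds: "1 * (norm (G i (zh k) - x k i))\<^sup>2 \<le> gap k" "1 * (norm (y k i - wh k i))\<^sup>2 \<le> gap k" for k
    using gap_component[OF i] by simp_all
  show "(\<lambda>k. G i (zh k) - x k i) \<longlonglongrightarrow> 0"
    by (rule tendsto_zero_if_norm_square_le[OF bounds(1) zero_less_one gap_tendsto_0])
  show "(\<lambda>k. y k i - wh k i) \<longlonglongrightarrow> 0"
    by (rule tendsto_zero_if_norm_square_le[OF bounds(2) zero_less_one gap_tendsto_0])
qed

lemma grad_tendsto_0:
  assumes i: "i \<in> {..<n}"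
  shows "(\<lambda>k. grad k i) \<longlonglongrightarrow> 0"
proof -
  obtain C where C: "\<And>k. sqnorm {..<n} c (grad k) \<le> C * gap k"
    using sqnorm_grad_le_gap by blast
  show ?thesis
  proof (rule tendsto_zero_if_norm_square_le[where g = "\<lambda>k. C * gap k"])
    show "c i * (norm (grad k i))\<^sup>2 \<le> C * gap k" for k
      using sqnorm_component_le[where c = c and p = "grad k" and I = "{..<n}" and i = i] c_pos i C[of k]
      by (meson finite_lessThan less_imp_le order_trans)
    show "0 < c i"
      by (rule c_pos)
    show "(\<lambda>k. C * gap k) \<longlonglongrightarrow> 0"
      using gap_tendsto_0 by (rule tendsto_mult_right_zero)
  qed
qed

lemma Ph_minus_P:
  assumes i: "i \<in> {..<n}"
  shows "(\<lambda>k. Ph k i - P k i) \<longlonglongrightarrow> 0"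
proof -
  obtain q where "q \<in> S"
    using S_nonempty by blast
  note lim = inertial_conclusions(2)[OF this]
  have "(\<lambda>k. P k i - P (k - 1) i) \<longlonglongrightarrow> 0"
  proof (rule tendsto_zero_if_norm_square_le[OF _ c_pos lim])
    show "c i * (norm (P k i - P (k - 1) i))\<^sup>2 \<le> sqnorm {..<n} c (\<lambda>i. P k i - P (k - 1) i)" for k
      using sqnorm_component_le[where c = c and p = "\<lambda>i. P k i - P (k - 1) i" and I = "{..<n}" and i = i]
        c_pos i by (meson finite_lessThan less_imp_le)
  qed
  then have lim': "(\<lambda>k. \<alpha> * norm (P k i - P (k - 1) i)) \<longlonglongrightarrow> 0"
    by (intro tendsto_mult_right_zero tendsto_norm_zero)
  have "norm (Ph k i - P k i) \<le> \<alpha> * norm (P k i - P (k - 1) i)" for k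
    using i \<alpha>s[of k] \<alpha>s_le[of k] by (simp add: Ph_eq mult_right_mono)
  then show ?thesis
    by (intro Lim_null_comparison[OF always_eventually lim']) blast
qed

text \<open>The trial points differ from \<open>G i (zh k)\<close> and \<open>wh k i\<close> by null
  sequences, and adjoints move the linear maps onto the test vector. A general filter is allowed
  because the result serves both cluster points and the final limit.\<close>

lemma weak_limits_of_trial_points:
  assumes F: "F \<le> sequentially" and q: "weakly_tends_to {..<n} H P q F"
  shows "weakly_tends_to {1..n} H x (\<lambda>i. G i (q 0)) F"
    and "weakly_tends_to {1..n} H y (ext q) F"
proof -
  have q_mem: "q i \<in> H i" if "i \<in> {..<n}" for i
    using q that by (auto simp: weakly_tends_to_def)
  then have q0: "q 0 \<in> H 0"
    using n by simp
  have null: "((\<lambda>k. inner (a k) v) \<longlongrightarrow> 0) F" if "a \<longlonglongrightarrow> 0" for a and v :: 'a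
  proof -
    have "(a \<longlongrightarrow> 0) F"
      using F that by (rule tendsto_mono)
    then have "((\<lambda>k. inner (a k) v) \<longlongrightarrow> inner 0 v) F"
      by (intro tendsto_intros)
    then show ?thesis
      by simp
  qed
  have Ph: "((\<lambda>k. inner (Ph k i) v) \<longlongrightarrow> inner (q i) v) F" if "i \<in> {..<n}" "v \<in> H i" for i v
  proof -
    have "((\<lambda>k. inner (P k i) v + inner (Ph k i - P k i) v) \<longlongrightarrow> inner (q i) v + 0) F"
      using q that by (intro tendsto_add null Ph_minus_P) (auto simp: weakly_tends_to_def)
    then show ?thesis
      by (simp add: inner_diff_left)
  qed
  have zh: "((\<lambda>k. inner (zh k) v) \<longlongrightarrow> inner (q 0) v) F" if "v \<in> H 0" for v
    using Ph[of 0 v] that n by (simp add: Ph_def)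
  have wh: "((\<lambda>k. inner (wh k i) v) \<longlongrightarrow> inner (ext q i) v) F" if i: "i \<in> {1..n}" and v: "v \<in> H i" for i v
  proof (cases "i = n")
    case False
    then show ?thesis
      using Ph[of i v] i v by (simp add: Ph_def ext_less)
  next
    case True
    then have v0: "v \<in> H 0"
      using v H_n by simp
    \<comment> \<open>Testing the last dual component against \<open>v\<close> amounts to testing
      each other component against \<open>G j v\<close>, whose limits are known.\<close>
    have expand: "inner (ext p n) v = - (\<Sum>j=1..<n. inner (p j) (G j v))" for p
    proof -
      have "inner (adj j (p j)) v = inner (p j) (G j v)" if "j \<in> {1..<n}" for j
        using that v0 by (metis atLeastLessThan_iff atLeastAtMost_iff inner_adj inner_commute less_imp_le)
      then show ?thesis
        by (simp add: ext_last inner_sum_left)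
    qed
    have "((\<lambda>k. - (\<Sum>j=1..<n. inner (wh k j) (G j v))) \<longlongrightarrow> - (\<Sum>j=1..<n. inner (q j) (G j v))) F"
    proof (intro tendsto_minus tendsto_sum)
      fix j assume j: "j \<in> {1..<n}"
      then show "((\<lambda>k. inner (wh k j) (G j v)) \<longlongrightarrow> inner (q j) (G j v)) F"
        using Ph[of j "G j v"] G_mem[of j v] v0 by (simp add: Ph_def)
    qed
    then show ?thesis
      unfolding True expand[symmetric] ext_wh .
  qed
  show "weakly_tends_to {1..n} H x (\<lambda>i. G i (q 0)) F"
    unfolding weakly_tends_to_def
  proof (intro ballI conjI)
    fix i assume i: "i \<in> {1..n}"
    show "G i (q 0) \<in> H i"
      using i q0 by (rule G_mem)
    fix v
    have "((\<lambda>k. inner (zh k) (adj i v) - inner (G i (zh k) - x k i) v) \<longlongrightarrow> inner (q 0) (adj i v) - 0) F"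
      using i by (intro tendsto_diff zh null G_zh_minus_x adj_mem)
    then show "((\<lambda>k. inner (x k i) v) \<longlongrightarrow> inner (G i (q 0)) v) F"
      using i q0 zh_mem by (simp add: inner_adj[symmetric] inner_diff_left)
  qed
  show "weakly_tends_to {1..n} H y (ext q) F"
    unfolding weakly_tends_to_def
  proof (intro ballI conjI)
    fix i assume i: "i \<in> {1..n}"
    show "ext q i \<in> H i"
      using q_mem i by (intro ext_mem) auto
    fix v assume "v \<in> H i"
    then have "((\<lambda>k. inner (wh k i) v + inner (y k i - wh k i) v) \<longlongrightarrow> inner (ext q i) v + 0) F"
      using i by (intro tendsto_add wh null y_minus_wh)
    then show "((\<lambda>k. inner (y k i) v) \<longlongrightarrow> inner (ext q i) v) F"
      by (simp add: inner_diff_left)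
  qed
qed

section \<open>Boundedness and identification of cluster points\<close>

lemma Ph_bounded:
  assumes i: "i \<in> {..<n}"
  shows "bounded (range (\<lambda>k. Ph k i))"
proof -
  obtain q where q: "q \<in> S"
    using S_nonempty by blast
  have "bounded (range (\<lambda>k. P k i))"
    by (rule sqnorm_convergent_imp_bounded[where c = c and q = q and I = "{..<n}"])
      (use i c_pos inertial_conclusions(1)[OF q] in auto)
  moreover have "bounded (range (\<lambda>k. Ph k i - P k i))"
    using Ph_minus_P[OF i] by (rule convergent_imp_bounded)
  ultimately show ?thesis
    using bounded_plus_comp[of "\<lambda>k. P k i" UNIV "\<lambda>k. Ph k i - P k i"] by simp
qed

lemma x_n_bounded: "bounded (range (\<lambda>k. x k n))"
proof -
  have "(\<lambda>k. zh k - x k n) \<longlonglongrightarrow> 0"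
    using G_zh_minus_x[of n] n by (simp add: G_n zh_mem)
  then have "bounded (range (\<lambda>k. zh k - x k n))"
    by (rule convergent_imp_bounded)
  moreover have "bounded (range zh)"
    using Ph_bounded[of 0] n by (simp add: Ph_def)
  ultimately show ?thesis
    using bounded_minus_comp[of zh UNIV "\<lambda>k. zh k - x k n"] by simp
qed

lemma y_bounded:
  assumes i: "i \<in> {1..n}"
  shows "bounded (range (\<lambda>k. y k i))"
proof -
  obtain K where K: "1 \<le> K" "\<And>i u. i \<in> {1..n} \<Longrightarrow> u \<in> H 0 \<Longrightarrow> norm (G i u) \<le> K * norm u"
    using G_uniform_bound by blast
  have less: "bounded (range (\<lambda>k. wh k j))" if "j \<in> {1..<n}" for j
    using Ph_bounded[of j] that by (simp add: Ph_def)
  have "bounded (range (\<lambda>k. wh k i))"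
  proof (cases "i = n")
    case False
    then show ?thesis
      using less i by simp
  next
    case True
    have "\<forall>j\<in>{1..<n}. \<exists>B. \<forall>k. norm (wh k j) \<le> B"
      using less by (auto simp: bounded_iff)
    then obtain B where B: "\<And>j k. j \<in> {1..<n} \<Longrightarrow> norm (wh k j) \<le> B j"
      by metis
    have "norm (wh k n) \<le> (\<Sum>j=1..<n. K * B j)" for k
    proof -
      have "norm (wh k n) = norm (\<Sum>j=1..<n. adj j (wh k j))"
        using ext_last[of "wh k"] by (simp add: ext_wh)
      also have "\<dots> \<le> (\<Sum>j=1..<n. K * B j)"
      proof (rule sum_norm_le)
        fix j assume j: "j \<in> {1..<n}"
        have "norm (adj j (wh k j)) \<le> K * norm (wh k j)"
          using j K by (intro adj_norm_le) auto
        also have "\<dots> \<le> K * B j"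
          using B[OF j] K(1) by (intro mult_left_mono) auto
        finally show "norm (adj j (wh k j)) \<le> K * B j" .
      qed
      finally show ?thesis .
    qed
    then show ?thesis
      using True by (auto simp: bounded_iff)
  qed
  moreover have "bounded (range (\<lambda>k. y k i - wh k i))"
    using y_minus_wh[OF i] by (rule convergent_imp_bounded)
  ultimately show ?thesis
    using bounded_plus_comp[of "\<lambda>k. wh k i" UNIV "\<lambda>k. y k i - wh k i"] by simp
qed

lemma weak_cluster_in_S:
  assumes F: "F \<le> sequentially" "F \<noteq> bot" and q: "weakly_tends_to {..<n} H P q F"
  shows "q \<in> S"
proof -
  have dual: "((\<lambda>k. dual_residual n H G (y k)) \<longlongrightarrow> 0) F"
  proof -
    have "(\<lambda>k. \<gamma> *\<^sub>R grad k 0) \<longlonglongrightarrow> \<gamma> *\<^sub>R 0"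
      using n by (intro tendsto_intros grad_tendsto_0) simp
    then have "(\<lambda>k. dual_residual n H G (y k)) \<longlonglongrightarrow> 0"
      using parameters(8) by (simp add: grad_def)
    then show ?thesis
      using F(1) by (rule tendsto_mono[rotated])
  qed
  have primal: "((\<lambda>k. primal_residual n G (x k) i) \<longlongrightarrow> 0) F" if "i \<in> {1..<n}" for i
    using tendsto_mono[OF F(1) grad_tendsto_0[of i]] that by (simp add: grad_def)
  have "(q 0, q) \<in> extended_solution_set n H T G"
  proof (rule weak_limit_is_solution[OF F(2)])
    show "x k i \<in> H i \<and> y k i \<in> T i (x k i)" if "i \<in> {1..n}" for k i
      using that x_mem y_T by blast
    show "q 0 \<in> H 0" "\<And>i. i \<in> {1..<n} \<Longrightarrow> q i \<in> H i"
      using q n by (auto simp: weakly_tends_to_def)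
  qed (use weak_limits_of_trial_points[OF F(1) q] x_n_bounded y_bounded dual primal in auto)
  then show ?thesis
    by (simp add: S_def)
qed

lemma weak_convergence:
  obtains q where "q \<in> S" "weakly_tends_to {..<n} H P q sequentially"
proof (rule opial[where I = "{..<n}" and H = H and P = P and c = c and S = S])
  show "hilbert_subspace (H i)" if "i \<in> {..<n}" for i
    using H that by simp
  show "q \<in> S" if "F \<le> sequentially" "F \<noteq> bot" "weakly_tends_to {..<n} H P q F" for q F
    using that by (rule weak_cluster_in_S)
qed (simp_all add: c_pos S_nonempty inertial_conclusions(1))

end

theorem theorem3p6:
  fixes n :: nat
    and H :: "nat \<Rightarrow> 'a::real_inner set"
    and T :: "nat \<Rightarrow> 'a \<Rightarrow> 'a set"
    and G :: "nat \<Rightarrow> 'a \<Rightarrow> 'a"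
    and \<alpha> \<sigma> \<beta>_lo \<beta>_hi \<gamma> \<alpha>_bar \<rho>_lo \<rho>_hi :: real
    and z :: "nat \<Rightarrow> 'a"
    and w x y e :: "nat \<Rightarrow> nat \<Rightarrow> 'a"
    and \<rho> :: "nat \<Rightarrow> nat \<Rightarrow> real"
    and \<alpha>s \<beta>s :: "nat \<Rightarrow> real"
  assumes n: "2 \<le> n"
    and H: "\<And>i. i \<in> {0..n} \<Longrightarrow> hilbert_subspace (H i)"
    and H_n: "H 0 = H n"
    and T: "\<And>i. i \<in> {1..n} \<Longrightarrow> maximal_monotone (H i) (T i)"
    and G: "\<And>i. i \<in> {1..n} \<Longrightarrow> bounded_linear_between (H 0) (H i) (G i)"
    and G_n: "\<And>u. u \<in> H 0 \<Longrightarrow> G n u = u"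
    and solvable: "\<exists>u\<in>H 0. 0 \<in> (\<Sum>i=1..n. adjoint_on (H 0) (G i) ` T i (G i u))"
    and run: "inertial_splitting_run n H T G \<alpha> \<sigma> \<beta>_lo \<beta>_hi \<gamma> z w x y e \<rho> \<alpha>s \<beta>s"
    and \<alpha>_bar: "0 < \<alpha>_bar" "\<alpha> < \<alpha>_bar" "\<alpha>_bar < 1"
    and \<alpha>s: "\<And>k. 0 \<le> \<alpha>s k \<and> \<alpha>s k \<le> \<alpha>s (Suc k) \<and> \<alpha>s (Suc k) \<le> \<alpha>"
    and \<beta>_hi: "\<beta>_hi = 2 * (\<alpha>_bar - 1)\<^sup>2 / (2 * (\<alpha>_bar - 1)\<^sup>2 + 3 * \<alpha>_bar - 1)"
    and \<rho>_lo: "0 < \<rho>_lo"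
    and \<rho>: "\<And>i k. i \<in> {1..n} \<Longrightarrow> \<rho>_lo \<le> \<rho> k i \<and> \<rho> k i \<le> \<rho>_hi"
  shows "\<exists>z_inf w_inf. (z_inf, w_inf) \<in> extended_solution_set n H T G \<and>
           weakly_converges (H 0) z z_inf \<and>
           (\<forall>i\<in>{1..<n}. weakly_converges (H i) (\<lambda>k. w k i) (w_inf i)) \<and>
           (\<forall>i\<in>{1..n}. weakly_converges (H i) (\<lambda>k. x k i) (G i z_inf) \<and>
                        weakly_converges (H i) (\<lambda>k. y k i) (dual_extend n H G w_inf i))"
proof -
  interpret inertial_splitting n H T G \<alpha> \<sigma> \<beta>_lo \<beta>_hi \<gamma> \<alpha>_bar \<rho>_lo \<rho>_hi z w x y e \<rho> \<alpha>s \<beta>s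
    by (intro inertial_splitting.intro splitting_problem.intro inertial_splitting_axioms.intro
        n H H_n T G G_n solvable run \<alpha>_bar \<alpha>s \<beta>_hi \<rho>_lo \<rho>)
  obtain q where q: "q \<in> S" and lim: "weakly_tends_to {..<n} H P q sequentially"
    using weak_convergence by blast
  \<comment> \<open>\<open>P_mem\<close> supplies the membership of the iterates that
    \<open>weakly_converges\<close> demands in addition.\<close>
  have P_lim: "weakly_converges (H i) (\<lambda>k. P k i) (q i)" if "i < n" for i
    using lim that P_mem by (auto simp: weakly_converges_def weakly_tends_to_def)
  have xy_lim: "weakly_converges (H i) (\<lambda>k. x k i) (G i (q 0))"
    "weakly_converges (H i) (\<lambda>k. y k i) (dual_extend n H G q i)" if "i \<in> {1..n}" for i
    using weak_limits_of_trial_points[OF order_refl lim] that x_mem y_mem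
    by (auto simp: weakly_converges_def weakly_tends_to_def)
  have "weakly_converges (H 0) z (q 0)"
    using P_lim[of 0] n by (simp add: P_def)
  moreover have "weakly_converges (H i) (\<lambda>k. w k i) (q i)" if "i \<in> {1..<n}" for i
    using P_lim[of i] that by (simp add: P_def)
  ultimately show ?thesis
    using q xy_lim unfolding S_def by blast
qed

end
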